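(* Let $\Bbbk$ be an algebraically closed field of characteristic zero, let $G=\mathbb{Z}_{m_1}\times\cdots\times\mathbb{Z}_{m_l}$ with $m_1\mid m_2\mid\cdots\mid m_l$ and fixed generators $g_1,\dots,g_l$ of the factors, and let $\omega$ be the $2$-cocycle on $G$ $$\omega(g_1^{i_1}\cdots g_l^{i_l},g_1^{j_1}\cdots g_l^{j_l})=\prod_{1\le r<s\le l}\zeta_{m_r}^{-a_{rs}i_sj_r}\qquad(0\le i_r,j_r<m_r),$$ with integers $0\le a_{rs}<m_r$. Let $B$ be the antisymmetric integer $l\times l$ matrix with $(i,j)$ entry $b_{ij}=\frac{m_l}{m_i}a_{ij}$ for $i<j$, zero diagonal, and $(j,i)$ entry $-b_{ij}$ for $i<j$. Let $\lambda_1\mid\lambda_2\mid\cdots\mid\lambda_k$ be the invariant factors of $B$. Let $G_0$ be the set of $\omega$-regular elements of $G$ and $d$ the common dimension of the irreducible $\omega$-representations of $G$. Then $$|G_0|=\frac{|G|}{\frac{m_l}{(m_l,\lambda_1)}\cdots\frac{m_l}{(m_l,\lambda_k)}},\qquad d=\sqrt{\frac{m_l}{(m_l,\lambda_1)}\cdots\frac{m_l}{(m_l,\lambda_k)}}.$$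
   Context: $\zeta_m$ is a fixed primitive $m$-th root of unity in $\Bbbk$, chosen compatibly so that $\zeta_{m_r}=\zeta_{m_l}^{m_l/m_r}$ for all $r$ (e.g. $\zeta_m=e^{2\pi i/m}$ when $\Bbbk=\mathbb{C}$). $(x,y)$ denotes the gcd. The set of $\omega$-regular elements is $G_0=\{x\in G\mid\omega(x,y)=\omega(y,x)\text{ for all }y\in G\}$. An $\omega$-representation is a projective representation of $G$ over $\Bbbk$ with factor set $\omega$, i.e. a map $\rho:G\to GL(V)$, with $V$ a finite-dimensional $\Bbbk$-vector space, satisfying $\rho(x)\rho(y)=\omega(x,y)\rho(xy)$. It is well known that the number of irreducible $\omega$-representations of $G$ is $|G_0|$ and that all of them have the same dimension $d=\sqrt{|G|/|G_0|}$. The invariant factors of $B$ are the nonzero diagonal entries of its Smith normal form over $\mathbb{Z}$ (so $k$ is the rank of $B$; an empty product is $1$). *)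

theory Defs
  imports
    "HOL-Algebra.Algebra"
    "HOL-Library.Function_Algebras"
    "HOL-Computational_Algebra.Polynomial"
    "Jordan_Normal_Form.Matrix"
begin

definition primitive_root_of_unity :: "nat \<Rightarrow> 'k::field \<Rightarrow> bool" where
  "primitive_root_of_unity n z \<longleftrightarrow> n > 0 \<and> z ^ n = 1 \<and> (\<forall>j. 0 < j \<and> j < n \<longrightarrow> z ^ j \<noteq> 1)"

text \<open>
  The group $G$ is realised as the external direct product of the cyclic groups of order
  $m_1, \dots, m_l$. Its elements are functions on $\{1..l\}$ (extended by \<open>undefined\<close>), and
  the neutral element of every factor is the integer $0$.
\<close>

definition cyclic_product :: "nat \<Rightarrow> (nat \<Rightarrow> nat) \<Rightarrow> (nat \<Rightarrow> int) monoid" where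
  "cyclic_product l m = product_group {1..l} (\<lambda>r. integer_mod_group (m r))"

definition cyclic_factor :: "nat \<Rightarrow> (nat \<Rightarrow> nat) \<Rightarrow> nat \<Rightarrow> (nat \<Rightarrow> int) set" where
  "cyclic_factor l m r = {x \<in> carrier (cyclic_product l m). \<forall>s\<in>{1..l} - {r}. x s = 0}"

definition regular_elements :: "('g, 'b) monoid_scheme \<Rightarrow> ('g \<Rightarrow> 'g \<Rightarrow> 'k) \<Rightarrow> 'g set" where
  "regular_elements G \<omega> = {x \<in> carrier G. \<forall>y\<in>carrier G. \<omega> x y = \<omega> y x}"

text \<open>
  The representation space is a finite-dimensional subspace \<open>V\<close> of a vector space whose
  carrier is a whole type. For \<open>x\<close> in \<open>G\<close> only the restriction of \<open>\<rho> x\<close> to \<open>V\<close> matters, and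
  it is required to be an element of $GL(V)$.
\<close>

locale projective_representation = vector_space scale
  for scale :: "'k::field \<Rightarrow> 'v::ab_group_add \<Rightarrow> 'v" +
  fixes G :: "('g, 'b) monoid_scheme" (structure)
    and \<omega> :: "'g \<Rightarrow> 'g \<Rightarrow> 'k"
    and V :: "'v set"
    and \<rho> :: "'g \<Rightarrow> 'v \<Rightarrow> 'v"
  assumes subspace_V: "subspace V"
    and finite_dim_V: "\<exists>S. finite S \<and> V = span S"
    and rho_bij: "x \<in> carrier G \<Longrightarrow> bij_betw (\<rho> x) V V"
    and rho_add: "\<lbrakk>x \<in> carrier G; u \<in> V; v \<in> V\<rbrakk> \<Longrightarrow> \<rho> x (u + v) = \<rho> x u + \<rho> x v"
    and rho_scale: "\<lbrakk>x \<in> carrier G; v \<in> V\<rbrakk> \<Longrightarrow> \<rho> x (scale c v) = scale c (\<rho> x v)"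
    and rho_mult: "\<lbrakk>x \<in> carrier G; y \<in> carrier G; v \<in> V\<rbrakk> \<Longrightarrow>
      \<rho> x (\<rho> y v) = scale (\<omega> x y) (\<rho> (x \<otimes> y) v)"

locale irreducible_projective_representation = projective_representation +
  assumes nonzero: "V \<noteq> {0}"
    and irreducible: "\<lbrakk>subspace W; W \<subseteq> V; \<And>x. x \<in> carrier G \<Longrightarrow> \<rho> x ` W \<subseteq> W\<rbrakk> \<Longrightarrow> W = {0} \<or> W = V"

text \<open>Rows and columns of matrices are numbered from $0$, the indices of \<open>m\<close> and \<open>a\<close> from $1$.\<close>

definition B_matrix :: "nat \<Rightarrow> (nat \<Rightarrow> nat) \<Rightarrow> (nat \<Rightarrow> nat \<Rightarrow> int) \<Rightarrow> int mat" where
  "B_matrix l m a =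
    (let b = (\<lambda>i j. int (m l div m i) * a i j)
     in mat l l (\<lambda>(i, j). if i < j then b (Suc i) (Suc j)
                          else if j < i then - b (Suc j) (Suc i)
                          else 0))"

definition smith_normal_form :: "int mat \<Rightarrow> int mat \<Rightarrow> bool" where
  "smith_normal_form A S \<longleftrightarrow>
    S \<in> carrier_mat (dim_row A) (dim_col A) \<and> diagonal_mat S \<and>
    (\<forall>i < min (dim_row A) (dim_col A). S $$ (i, i) \<ge> 0) \<and>
    (\<forall>i. Suc i < min (dim_row A) (dim_col A) \<longrightarrow> S $$ (i, i) dvd S $$ (Suc i, Suc i)) \<and>
    (\<exists>P Q. P \<in> carrier_mat (dim_row A) (dim_row A) \<and> invertible_mat P \<and>
           Q \<in> carrier_mat (dim_col A) (dim_col A) \<and> invertible_mat Q \<and>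
           S = P * A * Q)"

definition invariant_factors :: "int mat \<Rightarrow> int list \<Rightarrow> bool" where
  "invariant_factors A lams \<longleftrightarrow>
    (\<exists>S. smith_normal_form A S \<and>
         lams = filter (\<lambda>c. c \<noteq> 0) (map (\<lambda>i. S $$ (i, i)) [0..<min (dim_row A) (dim_col A)]))"

end

theory Submission
  imports Defs "HOL-Number_Theory.Cong"
begin

text \<open>
  Let $\beta(x,y) = \omega(x,y)/\omega(y,x)$. This is an alternating bicharacter on $G$, and
  $G_0$ is its radical. The proof splits into a statement that holds for every finite abelian
  group with a cocycle, namely $d^2\,|G_0| = |G|$, and the computation of $|G_0|$ for the given
  cocycle.

  For the first part, choose a subset $H$ of $G$ that is maximal among those on which $\beta$ is
  trivial. Maximality forces $H$ to be its own orthogonal complement, so $H$ is a subgroup, and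
  summing $\beta$ over $G \times H$ in both orders gives $|H|^2 = |G|\,|G_0|$
  (\<open>card_lagrangian\<close>). In an irreducible $\omega$-representation the operators $\rho(h)$ with
  $h \in H$ commute, so over an algebraically closed field they have a common eigenvector $v$.
  The vectors $\rho(t)v$, with $t$ running through representatives of the cosets of $H$, span an
  invariant subspace, hence everything; they are linearly independent because $H$ acts on them
  through pairwise distinct characters, exactly since $H$ is its own complement. Hence $d = |G|/|H|$ and
  $d^2\,|G_0| = |G|$ (\<open>dim_mult_card_lagrangian\<close>, \<open>dim_squared\<close>). Irreducible representations
  exist: take a nonzero invariant subspace of least dimension in the twisted regular
  representation.

  For the second part, write the elements of $G$ in coordinates with respect to
  $g_1, \dots, g_l$. Then $\beta(x,y) = \zeta_{m_l}^{c(x)^T B\, c(y)}$, so that $x$ is regular if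
  and only if $B\,c(x) \equiv 0$ modulo $m_l$. The solutions $f$ of $B f \equiv 0$ in
  $(\mathbb{Z}/m_l)^l$ map onto $G_0$ with all fibres of size $\prod_i m_l/m_i$. Their number does
  not change when $B$ is multiplied by unimodular matrices on either side, so it can be read off
  from the Smith normal form: it is $\prod_i \gcd(m_l, s_i)$ over the diagonal entries $s_i$.
  A zero entry contributes $m_l$, that is, a factor $m_l/\gcd(m_l,0) = 1$ to the quotient
  $|G|/|G_0|$, so only the invariant factors remain.
\<close>

section \<open>The commutator bicharacter and Lagrangian subgroups\<close>

text \<open>
  Translation by an element $y$ of the subgroup permutes the summands and multiplies the sum by
  $\chi(y)$, so the sum vanishes as soon as some $\chi(y) \neq 1$.
\<close>

lemma (in group) sum_multiplicative_function:
  fixes \<chi> :: "'a \<Rightarrow> 'k::field"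
  assumes H: "subgroup H G" "finite H"
    and mult: "\<And>x y. x \<in> H \<Longrightarrow> y \<in> H \<Longrightarrow> \<chi> (x \<otimes> y) = \<chi> x * \<chi> y"
  shows "(\<Sum>x\<in>H. \<chi> x) = (if \<forall>x\<in>H. \<chi> x = 1 then of_nat (card H) else 0)"
proof (cases "\<forall>x\<in>H. \<chi> x = 1")
  case False
  then obtain y where y: "y \<in> H" "\<chi> y \<noteq> 1" by blast
  have HG: "H \<subseteq> carrier G" by (rule subgroup.subset[OF H(1)])
  have "bij_betw (\<lambda>x. y \<otimes> x) H H"
    by (rule bij_betw_byWitness[where f' = "\<lambda>x. inv y \<otimes> x"])
      (use y HG in \<open>auto simp: subsetD m_assoc[symmetric] subgroup.m_closed[OF H(1)]
        subgroup.m_inv_closed[OF H(1)]\<close>)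
  then have "(\<Sum>x\<in>H. \<chi> x) = (\<Sum>x\<in>H. \<chi> (y \<otimes> x))"
    by (rule sum.reindex_bij_betw[symmetric])
  also have "\<dots> = \<chi> y * (\<Sum>x\<in>H. \<chi> x)"
    by (simp add: mult y sum_distrib_left)
  finally have "(1 - \<chi> y) * (\<Sum>x\<in>H. \<chi> x) = 0"
    by (simp add: algebra_simps)
  then show ?thesis using y False by auto
qed simp

locale finite_abelian_cocycle = comm_group G for G :: "('g, 'b) monoid_scheme" (structure) +
  fixes \<omega> :: "'g \<Rightarrow> 'g \<Rightarrow> 'k::field_char_0"
  assumes finite_carrier: "finite (carrier G)"
    and nonzero_cocycle: "\<lbrakk>x \<in> carrier G; y \<in> carrier G\<rbrakk> \<Longrightarrow> \<omega> x y \<noteq> 0"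
    and cocycle: "\<lbrakk>x \<in> carrier G; y \<in> carrier G; z \<in> carrier G\<rbrakk> \<Longrightarrow>
      \<omega> x y * \<omega> (x \<otimes> y) z = \<omega> x (y \<otimes> z) * \<omega> y z"
begin

text \<open>
  For every $\omega$-representation this is the scalar by which $\rho(x)\rho(y)$ differs from
  $\rho(y)\rho(x)$, see \<open>rho_commute\<close>.
\<close>

definition commutator :: "'g \<Rightarrow> 'g \<Rightarrow> 'k" where
  "commutator x y = \<omega> x y / \<omega> y x"

lemma commutator_nonzero:
  "\<lbrakk>x \<in> carrier G; y \<in> carrier G\<rbrakk> \<Longrightarrow> commutator x y \<noteq> 0"
  by (simp add: commutator_def nonzero_cocycle)

lemma commutator_eq_1_iff:
  "\<lbrakk>x \<in> carrier G; y \<in> carrier G\<rbrakk> \<Longrightarrow> commutator x y = 1 \<longleftrightarrow> \<omega> x y = \<omega> y x"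
  by (simp add: commutator_def nonzero_cocycle)

lemma commutator_self: "x \<in> carrier G \<Longrightarrow> commutator x x = 1"
  by (simp add: commutator_def nonzero_cocycle)

lemma commutator_swap:
  "\<lbrakk>x \<in> carrier G; y \<in> carrier G\<rbrakk> \<Longrightarrow> commutator y x = inverse (commutator x y)"
  by (simp add: commutator_def)

text \<open>
  The cocycle identities for $(x,y,z)$, $(z,x,y)$ and $(x,z,y)$ express $\omega(xy,z)$,
  $\omega(z,xy)$ and $\omega(x,yz)$ by other values; in the quotient all terms with products
  cancel, because $G$ is commutative.
\<close>

lemma commutator_mult_left:
  assumes x: "x \<in> carrier G" and y: "y \<in> carrier G" and z: "z \<in> carrier G"
  shows "commutator (x \<otimes> y) z = commutator x z * commutator y z"
proof -
  note nz = nonzero_cocycle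
  have c1: "\<omega> x y * \<omega> (x \<otimes> y) z = \<omega> x (y \<otimes> z) * \<omega> y z" by (rule cocycle[OF x y z])
  have c2: "\<omega> z x * \<omega> (x \<otimes> z) y = \<omega> z (x \<otimes> y) * \<omega> x y"
    using cocycle[OF z x y] by (simp add: m_comm[OF z x])
  have c3: "\<omega> x z * \<omega> (x \<otimes> z) y = \<omega> x (y \<otimes> z) * \<omega> z y"
    using cocycle[OF x z y] by (simp add: m_comm[OF z y])
  have e1: "\<omega> (x \<otimes> y) z = \<omega> x (y \<otimes> z) * \<omega> y z / \<omega> x y"
    using c1 nz[OF x y] by (simp add: field_simps)
  have e2: "\<omega> z (x \<otimes> y) = \<omega> z x * \<omega> (x \<otimes> z) y / \<omega> x y"
    using c2 nz[OF x y] by (simp add: field_simps)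
  have e3: "\<omega> x (y \<otimes> z) = \<omega> x z * \<omega> (x \<otimes> z) y / \<omega> z y"
    using c3 nz[OF z y] by (simp add: field_simps)
  have "\<omega> (x \<otimes> z) y \<noteq> 0" by (simp add: nz x y z)
  then show ?thesis unfolding commutator_def e1 e2 e3
    using nz[OF x y] nz[OF z y] by (simp add: field_simps)
qed

lemma commutator_mult_right:
  assumes "x \<in> carrier G" "y \<in> carrier G" "z \<in> carrier G"
  shows "commutator x (y \<otimes> z) = commutator x y * commutator x z"
  using commutator_mult_left[of y z x] assms
  by (simp add: commutator_swap[of _ x])

lemma commutator_one_left: "x \<in> carrier G \<Longrightarrow> commutator \<one> x = 1"
  using commutator_mult_left[of \<one> \<one> x] commutator_nonzero[of \<one> x] by simp

lemma commutator_inv_left: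
  "\<lbrakk>x \<in> carrier G; y \<in> carrier G\<rbrakk> \<Longrightarrow> commutator (inv x) y = inverse (commutator x y)"
  using commutator_mult_left[of "inv x" x y] commutator_one_left[of y]
  by (simp add: field_simps commutator_nonzero inverse_unique)

lemma regular_elements_eq:
  "regular_elements G \<omega> = {x \<in> carrier G. \<forall>y\<in>carrier G. commutator x y = 1}"
  by (auto simp: regular_elements_def commutator_eq_1_iff)

text \<open>
  The name is that of subspaces of a symplectic space that equal their own orthogonal
  complement. As an orthogonal complement, such a set $H$ is automatically a subgroup.
\<close>

definition lagrangian :: "'g set \<Rightarrow> bool" where
  "lagrangian H \<longleftrightarrow> H = {x \<in> carrier G. \<forall>h\<in>H. commutator x h = 1}"

text \<open>
  If $x$ is orthogonal to a maximal isotropic subset $H$, then $H \cup \{x\}$ is isotropic as well,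
  because $\beta(x,x) = 1$. Since isotropic subsets rather than subgroups are considered, nothing
  has to be generated.
\<close>

lemma lagrangian_exists: "\<exists>H. lagrangian H"
proof -
  let ?I = "{H. H \<subseteq> carrier G \<and> (\<forall>x\<in>H. \<forall>y\<in>H. commutator x y = 1)}"
  have "finite ?I" using finite_carrier by (auto intro: finite_subset[of _ "Pow (carrier G)"])
  moreover have "{} \<in> ?I" by simp
  ultimately obtain H where H: "H \<in> ?I" and max: "\<And>K. K \<in> ?I \<Longrightarrow> H \<subseteq> K \<Longrightarrow> K = H"
    using finite_has_maximal[of ?I] by (metis (no_types, lifting) empty_iff)
  have "x \<in> H" if x: "x \<in> carrier G" and perp: "\<forall>h\<in>H. commutator x h = 1" for x
  proof -
    have "insert x H \<in> ?I"
      using H x perp by (auto simp: commutator_self commutator_swap[of x] subset_iff)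
    then show ?thesis using max[of "insert x H"] by blast
  qed
  then show ?thesis using H by (auto simp: lagrangian_def intro!: exI[of _ H])
qed

lemma lagrangian_subset: "lagrangian H \<Longrightarrow> H \<subseteq> carrier G"
  by (auto simp: lagrangian_def)

lemma lagrangian_perp:
  assumes "lagrangian H" "x \<in> carrier G"
  shows "(\<forall>h\<in>H. commutator h x = 1) \<longleftrightarrow> x \<in> H"
proof -
  have "(\<forall>h\<in>H. commutator h x = 1) \<longleftrightarrow> (\<forall>h\<in>H. commutator x h = 1)"
    using assms lagrangian_subset[OF assms(1)] by (auto simp: commutator_eq_1_iff subsetD)
  then show ?thesis using assms unfolding lagrangian_def by blast
qed

lemma lagrangian_subgroup:
  assumes H: "lagrangian H"
  shows "subgroup H G"
proof (rule subgroupI)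
  note HG = lagrangian_subset[OF H]
  have mem: "x \<in> H \<longleftrightarrow> (\<forall>h\<in>H. commutator x h = 1)" if "x \<in> carrier G" for x
    using H that unfolding lagrangian_def by blast
  show "H \<subseteq> carrier G" by (rule HG)
  have "\<one> \<in> H" using mem[of \<one>] HG by (auto simp: commutator_one_left)
  then show "H \<noteq> {}" by blast
  show "inv x \<in> H" if "x \<in> H" for x
    using mem[of x] mem[of "inv x"] that HG by (auto simp: commutator_inv_left subsetD)
  show "x \<otimes> y \<in> H" if "x \<in> H" "y \<in> H" for x y
    using mem[of x] mem[of y] mem[of "x \<otimes> y"] that HG
    by (auto simp: commutator_mult_left subsetD)
qed

text \<open>
  Orthogonality of characters: $h \mapsto \beta(h,x)$ is a character of $H$, and it is trivial only
  for $x \in H$. This both counts $H$ and separates the weight spaces of $H$ in a representation.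
\<close>

lemma lagrangian_sum:
  assumes H: "lagrangian H" and x: "x \<in> carrier G"
  shows "(\<Sum>h\<in>H. commutator h x) = (if x \<in> H then of_nat (card H) else 0)"
proof -
  note HG = lagrangian_subset[OF H]
  have "(\<Sum>h\<in>H. commutator h x) = (if \<forall>h\<in>H. commutator h x = 1 then of_nat (card H) else 0)"
    by (rule sum_multiplicative_function[OF lagrangian_subgroup[OF H]])
      (use HG x finite_carrier in \<open>auto simp: commutator_mult_left subsetD finite_subset\<close>)
  then show ?thesis by (simp add: lagrangian_perp[OF H x])
qed

text \<open>
  Both sides are the sum of $\beta(h,x)$ over $h \in H$ and $x \in G$. Summing over $h$ first leaves
  the $x \in H$, since $H$ is its own complement; summing over $x$ first leaves the $h \in G_0$.
\<close>

lemma card_lagrangian: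
  assumes H: "lagrangian H"
  shows "card H ^ 2 = Coset.order G * card (regular_elements G \<omega>)"
proof -
  note HG = lagrangian_subset[OF H]
  have fin: "finite H" using HG finite_carrier by (rule finite_subset)
  have reg: "regular_elements G \<omega> \<subseteq> H"
    using H unfolding regular_elements_eq lagrangian_def by blast
  have "(\<Sum>x\<in>carrier G. \<Sum>h\<in>H. commutator h x) = (\<Sum>x\<in>carrier G. if x \<in> H then of_nat (card H) else 0)"
    by (intro sum.cong refl lagrangian_sum[OF H])
  also have "\<dots> = of_nat (card H ^ 2)"
    using HG finite_carrier by (simp add: sum.If_cases Int_absorb1 power2_eq_square)
  finally have 1: "(\<Sum>x\<in>carrier G. \<Sum>h\<in>H. commutator h x) = of_nat (card H ^ 2)" .
  have "(\<Sum>x\<in>carrier G. commutator h x) =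
      (if h \<in> regular_elements G \<omega> then of_nat (Coset.order G) else 0)" if h: "h \<in> H" for h
  proof -
    have "(\<Sum>x\<in>carrier G. commutator h x) =
        (if \<forall>x\<in>carrier G. commutator h x = 1 then of_nat (card (carrier G)) else 0)"
      by (rule sum_multiplicative_function[OF subgroup_self finite_carrier])
        (use h HG in \<open>auto simp: commutator_mult_right\<close>)
    then show ?thesis using h HG by (auto simp: regular_elements_eq Coset.order_def)
  qed
  then have "(\<Sum>h\<in>H. \<Sum>x\<in>carrier G. commutator h x) =
      (\<Sum>h\<in>H. if h \<in> regular_elements G \<omega> then of_nat (Coset.order G) else 0)"
    by (rule sum.cong[OF refl])
  also have "\<dots> = of_nat (Coset.order G * card (regular_elements G \<omega>))"
    using reg fin by (simp add: sum.If_cases Int_absorb1 mult.commute)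
  finally have "of_nat (card H ^ 2) = (of_nat (Coset.order G * card (regular_elements G \<omega>)) :: 'k)"
    using 1 sum.swap[of "\<lambda>x h. commutator h x" H "carrier G"] by simp
  then show ?thesis by (simp only: of_nat_eq_iff)
qed

end

section \<open>Eigenvectors and dimensions of invariant subspaces\<close>

text \<open>
  Split off a linear factor $X - \alpha$ of $p$: either $Tw - \alpha w = 0$ and $w$ is an eigenvector,
  or the remaining factor annihilates the nonzero vector $Tw - \alpha w$ and has smaller degree.
  The hypotheses on $T$ are restricted to $W$ because the operators of a representation are
  linear only there.
\<close>

lemma eigenvector_of_annihilating_polynomial:
  fixes scale :: "'k::alg_closed_field \<Rightarrow> 'v::ab_group_add \<Rightarrow> 'v" and p :: "'k poly"
  assumes "vector_space scale"
    and W: "module.subspace scale W"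
    and T_closed: "\<And>v. v \<in> W \<Longrightarrow> T v \<in> W"
    and T_add: "\<And>u v. u \<in> W \<Longrightarrow> v \<in> W \<Longrightarrow> T (u + v) = T u + T v"
    and T_scale: "\<And>c v. v \<in> W \<Longrightarrow> T (scale c v) = scale c (T v)"
    and p: "p \<noteq> 0"
    and w: "w \<in> W" "w \<noteq> 0"
    and annihilates: "(\<Sum>i\<le>degree p. scale (coeff p i) ((T ^^ i) w)) = 0"
  shows "\<exists>v\<in>W. v \<noteq> 0 \<and> (\<exists>c. T v = scale c v)"
proof -
  interpret vector_space scale by fact
  have pow_closed: "(T ^^ i) v \<in> W" if "v \<in> W" for i v
    by (induction i) (auto simp: that T_closed)
  have pow_diff: "(T ^^ i) (T v - scale c v) = (T ^^ Suc i) v - scale c ((T ^^ i) v)"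
    if v: "v \<in> W" for i c v
  proof (induction i)
    case (Suc i)
    have "T (u - scale c u') = T u - scale c (T u')" if "u \<in> W" "u' \<in> W" for u u'
      using T_add[of u "scale (- c) u'"] T_scale[of u' "- c"] that subspace_scale[OF W, of u' "- c"]
      by simp
    then show ?case using Suc pow_closed[OF v] by (simp add: T_closed)
  qed simp
  show ?thesis using p w annihilates
  proof (induction "degree p" arbitrary: p w)
    case 0
    then have "coeff p 0 \<noteq> 0" by (metis leading_coeff_0_iff)
    then show ?case using 0 by simp
  next
    case (Suc n)
    then obtain \<alpha> where "poly p \<alpha> = 0"
      using alg_closed_imp_poly_has_root[of p] by auto
    then obtain q where q: "p = [:-\<alpha>, 1:] * q" by (auto simp: poly_eq_0_iff_dvd)
    have q0: "q \<noteq> 0" using Suc.prems(1) q by auto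
    have deg: "degree q = n" using Suc.hyps(2) q0 unfolding q by (subst (asm) degree_mult_eq) auto
    let ?u = "T w - scale \<alpha> w"
    have uW: "?u \<in> W" using Suc.prems T_closed by (intro subspace_diff[OF W] subspace_scale[OF W]) auto
    show ?case
    proof (cases "?u = 0")
      case True
      then show ?thesis using Suc.prems by auto
    next
      case False
      have top: "(\<Sum>i\<le>Suc n. scale (coeff q i) ((T ^^ i) w)) = (\<Sum>i\<le>n. scale (coeff q i) ((T ^^ i) w))"
        using deg by (simp add: coeff_eq_0)
      have "(\<Sum>i\<le>n. scale (coeff q i) ((T ^^ i) ?u)) =
          (\<Sum>i\<le>n. scale (coeff q i) ((T ^^ Suc i) w)) - scale \<alpha> (\<Sum>i\<le>Suc n. scale (coeff q i) ((T ^^ i) w))"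
        unfolding top using Suc.prems(2) by (simp add: pow_diff scale_right_diff_distrib sum_subtractf scale_sum_right mult.commute del: funpow.simps)
      also have "(\<Sum>i\<le>n. scale (coeff q i) ((T ^^ Suc i) w)) =
          (\<Sum>i\<le>Suc n. scale (coeff (pCons 0 q) i) ((T ^^ i) w))"
        by (subst sum.atMost_Suc_shift) simp
      also have "\<dots> - scale \<alpha> (\<Sum>i\<le>Suc n. scale (coeff q i) ((T ^^ i) w)) =
          (\<Sum>i\<le>Suc n. scale (coeff p i) ((T ^^ i) w))"
        by (simp add: q scale_sum_right sum_subtractf[symmetric] scale_left_diff_distrib[symmetric] del: sum.atMost_Suc)
      also have "\<dots> = 0" using Suc.prems(4) Suc.hyps(2) by simp
      finally show ?thesis using Suc.hyps(1)[of q ?u] deg q0 uW False by simp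
    qed
  qed
qed

context vector_space
begin

lemma subspace_of_finite_dim:
  assumes W: "subspace W" "W \<subseteq> span S" "finite S"
  obtains B where "finite B" "independent B" "W = span B" "dim W = card B"
proof -
  obtain B where B: "B \<subseteq> W" "independent B" "W \<subseteq> span B" "card B = dim W" by (rule basis_exists)
  then have "finite B" using independent_span_bound[of S B] W by blast
  moreover have "W = span B" using B span_minimal[OF B(1) W(1)] by blast
  ultimately show thesis using that[of B] B by simp
qed

text \<open>
  The ambient space may be of infinite dimension, so the comparison is carried out inside the
  span of a finite set.
\<close>

lemma dim_psubspace_less:
  assumes W: "subspace W" "W \<subseteq> span S" "finite S" and W': "subspace W'" "W' \<subset> W"
  shows "dim W' < dim W"
proof -
  obtain B where B: "finite B" "independent B" "W = span B" "dim W = card B"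
    using subspace_of_finite_dim[OF W] .
  have "W' \<subseteq> span S" using W W' by blast
  then obtain B' where B': "finite B'" "independent B'" "W' = span B'" "dim W' = card B'"
    using subspace_of_finite_dim[OF W'(1) _ W(3)] by blast
  obtain w where w: "w \<in> W" "w \<notin> W'" using W' by blast
  have "independent (insert w B')" using B' w by (simp add: independent_insertI)
  moreover have "insert w B' \<subseteq> span B" using w B' B W'(2) span_superset[of B'] by auto
  ultimately have "card (insert w B') \<le> card B" using independent_span_bound[OF B(1)] by blast
  moreover have "w \<notin> B'" using w(2) B'(3) span_superset[of B'] by blast
  ultimately show ?thesis using B B' by simp
qed

end


section \<open>Projective representations of finite abelian groups\<close>

locale abelian_projective_representation =
  finite_abelian_cocycle G \<omega> + projective_representation scale G \<omega> V \<rho>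
  for G :: "('g, 'b) monoid_scheme" (structure) and \<omega> :: "'g \<Rightarrow> 'g \<Rightarrow> 'k::field_char_0"
    and scale :: "'k \<Rightarrow> 'v::ab_group_add \<Rightarrow> 'v" and V \<rho>
begin

lemma rho_closed: "\<lbrakk>x \<in> carrier G; v \<in> V\<rbrakk> \<Longrightarrow> \<rho> x v \<in> V"
  using rho_bij by (auto simp: bij_betw_def)

lemma rho_inject: "\<lbrakk>x \<in> carrier G; u \<in> V; v \<in> V\<rbrakk> \<Longrightarrow> \<rho> x u = \<rho> x v \<longleftrightarrow> u = v"
  using rho_bij[of x] by (auto simp: bij_betw_def inj_on_def)

lemma rho_zero: "x \<in> carrier G \<Longrightarrow> \<rho> x 0 = 0"
  using rho_scale[of x 0 0] subspace_0[OF subspace_V] by simp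

lemma rho_eq_0_iff: "\<lbrakk>x \<in> carrier G; v \<in> V\<rbrakk> \<Longrightarrow> \<rho> x v = 0 \<longleftrightarrow> v = 0"
  using rho_inject[of x v 0] rho_zero subspace_0[OF subspace_V] by auto

lemma rho_sum:
  assumes x: "x \<in> carrier G" and "finite I" "\<And>i. i \<in> I \<Longrightarrow> f i \<in> V"
  shows "\<rho> x (\<Sum>i\<in>I. f i) = (\<Sum>i\<in>I. \<rho> x (f i))"
  using assms(2,3)
  by (induction I rule: finite_induct) (auto simp: rho_zero[OF x] rho_add[OF x] subspace_sum[OF subspace_V])

text \<open>
  The operator $\rho(1)$ is invertible and satisfies $\rho(1)^2 = \omega(1,1)\rho(1)$. It is the
  identity only if the cocycle is normalised.
\<close>

lemma rho_one:
  assumes v: "v \<in> V"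
  shows "\<rho> \<one> v = scale (\<omega> \<one> \<one>) v"
proof -
  have "\<rho> \<one> (\<rho> \<one> v) = \<rho> \<one> (scale (\<omega> \<one> \<one>) v)"
    using rho_mult[of \<one> \<one> v] v by (simp add: rho_scale)
  then show ?thesis
    using rho_inject[of \<one> "\<rho> \<one> v"] v by (simp add: rho_closed subspace_scale[OF subspace_V])
qed

lemma rho_commute:
  assumes x: "x \<in> carrier G" and y: "y \<in> carrier G" and v: "v \<in> V"
  shows "\<rho> x (\<rho> y v) = scale (commutator x y) (\<rho> y (\<rho> x v))"
  using nonzero_cocycle[OF y x]
  by (simp add: rho_mult[OF x y v] rho_mult[OF y x v] m_comm[OF y x] commutator_def)

lemma rho_funpow:
  assumes x: "x \<in> carrier G"
  shows "\<exists>c. \<forall>v\<in>V. (\<rho> x ^^ n) v = scale c (\<rho> (x [^] n) v)"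
proof (induction n)
  case 0
  show ?case
    by (rule exI[of _ "inverse (\<omega> \<one> \<one>)"]) (simp add: rho_one nonzero_cocycle)
next
  case (Suc n)
  then obtain c where "\<forall>v\<in>V. (\<rho> x ^^ n) v = scale c (\<rho> (x [^] n) v)" by blast
  then have "\<forall>v\<in>V. (\<rho> x ^^ Suc n) v = scale (c * \<omega> x (x [^] n)) (\<rho> (x [^] Suc n) v)"
    using x by (simp add: rho_scale rho_closed rho_mult m_comm)
  then show ?case by blast
qed

text \<open>
  Each operator $\rho(x)$ is therefore annihilated by a polynomial $X^N - c$; this is what provides
  its eigenvectors.
\<close>

lemma rho_funpow_order:
  assumes x: "x \<in> carrier G"
  shows "\<exists>c. \<forall>v\<in>V. (\<rho> x ^^ Coset.order G) v = scale c v"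
proof -
  obtain c where "\<forall>v\<in>V. (\<rho> x ^^ Coset.order G) v = scale c (\<rho> (x [^] Coset.order G) v)"
    using rho_funpow[OF x] by blast
  then have "\<forall>v\<in>V. (\<rho> x ^^ Coset.order G) v = scale (c * \<omega> \<one> \<one>) v"
    using x by (simp add: pow_order_eq_1 rho_one)
  then show ?thesis by blast
qed

text \<open>
  An invariant subspace is mapped onto itself, since up to a nonzero scalar the inverse of $\rho(x)$
  is $\rho(x^{-1})$, which leaves it invariant too.
\<close>

lemma projective_representation_invariant_subspace:
  assumes W: "subspace W" "W \<subseteq> V" and inv: "\<And>x. x \<in> carrier G \<Longrightarrow> \<rho> x ` W \<subseteq> W"
  shows "projective_representation scale G \<omega> W \<rho>"
proof unfold_locales
  show "subspace W" by fact
  obtain S where "finite S" "V = span S" using finite_dim_V by blast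
  then show "\<exists>S. finite S \<and> W = span S" using subspace_of_finite_dim W by metis
next
  fix x assume x: "x \<in> carrier G"
  have "w \<in> \<rho> x ` W" if w: "w \<in> W" for w
  proof -
    let ?c = "\<omega> x (inv x) * \<omega> \<one> \<one>"
    have c: "?c \<noteq> 0" using x by (simp add: nonzero_cocycle)
    then have c': "inverse ?c * ?c = 1" by (rule field_class.field_inverse)
    have wV: "w \<in> V" using w W by blast
    have "\<rho> x (\<rho> (inv x) w) = scale ?c w"
      using x wV by (simp add: rho_mult rho_one)
    then have "\<rho> x (scale (inverse ?c) (\<rho> (inv x) w)) = w"
      using x wV by (simp only: rho_scale rho_closed inv_closed scale_scale c' scale_one)
    moreover have "scale (inverse ?c) (\<rho> (inv x) w) \<in> W"
      using inv[of "inv x"] x w by (intro subspace_scale[OF W(1)]) auto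
    ultimately show ?thesis by (metis imageI)
  qed
  then have "\<rho> x ` W = W" using inv[OF x] by blast
  moreover have "inj_on (\<rho> x) W" using rho_bij[OF x] W(2) by (auto simp: bij_betw_def intro: inj_on_subset)
  ultimately show "bij_betw (\<rho> x) W W" by (simp add: bij_betw_def)
qed (use W in \<open>auto simp: rho_add rho_scale rho_mult subsetD\<close>)

text \<open>
  A nonzero invariant subspace of least dimension is irreducible.
\<close>

lemma irreducible_subrepresentation_exists:
  assumes nz: "V \<noteq> {0}"
  shows "\<exists>W. irreducible_projective_representation scale G \<omega> W \<rho>"
proof -
  let ?P = "\<lambda>W. subspace W \<and> W \<subseteq> V \<and> (\<forall>x\<in>carrier G. \<rho> x ` W \<subseteq> W) \<and> W \<noteq> {0}"
  have "?P V" using nz subspace_V rho_closed by auto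
  then obtain W where W: "?P W" and min: "\<And>U. ?P U \<Longrightarrow> dim W \<le> dim U"
    using ex_has_least_nat[of ?P V dim] by blast
  obtain S where S: "finite S" "V = span S" using finite_dim_V by blast
  interpret W: projective_representation scale G \<omega> W \<rho>
    using W by (intro projective_representation_invariant_subspace) auto
  have "irreducible_projective_representation scale G \<omega> W \<rho>"
  proof unfold_locales
    fix U assume U: "subspace U" "U \<subseteq> W" "\<And>x. x \<in> carrier G \<Longrightarrow> \<rho> x ` U \<subseteq> U"
    show "U = {0} \<or> U = W"
    proof (rule ccontr)
      assume neg: "\<not> ?thesis"
      then have "?P U" using U W by auto
      then have "dim W \<le> dim U" by (rule min)
      moreover have "dim U < dim W"
        using W U neg S by (intro dim_psubspace_less[of W S U]) auto
      ultimately show False by simp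
    qed
  qed (use W in auto)
  then show ?thesis by blast
qed

end

section \<open>The dimension of an irreducible representation\<close>

locale abelian_irreducible_representation =
  finite_abelian_cocycle G \<omega> + irreducible_projective_representation scale G \<omega> V \<rho>
  for G :: "('g, 'b) monoid_scheme" (structure)
    and \<omega> :: "'g \<Rightarrow> 'g \<Rightarrow> 'k::{alg_closed_field, field_char_0}"
    and scale :: "'k \<Rightarrow> 'v::ab_group_add \<Rightarrow> 'v" and V \<rho>
begin

sublocale abelian_projective_representation G \<omega> scale V \<rho> ..

text \<open>
  Induction on the number of operators: the common eigenspace of the operators already treated,
  for fixed eigenvalues, is invariant under the next one because the operators commute.
\<close>

lemma common_eigenvector:
  assumes F: "finite F" "F \<subseteq> carrier G" and comm: "\<And>x y. x \<in> F \<Longrightarrow> y \<in> F \<Longrightarrow> commutator x y = 1"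
  shows "\<exists>v\<in>V. v \<noteq> 0 \<and> (\<forall>x\<in>F. \<exists>c. \<rho> x v = scale c v)"
  using F comm
proof (induction F rule: finite_induct)
  case empty
  then show ?case using nonzero subspace_0[OF subspace_V] by auto
next
  case (insert x F)
  have x: "x \<in> carrier G" using insert.prems by blast
  obtain v where v: "v \<in> V" "v \<noteq> 0" "\<forall>y\<in>F. \<exists>c. \<rho> y v = scale c v"
    using insert.IH insert.prems by auto
  then obtain \<mu> where \<mu>: "\<forall>y\<in>F. \<rho> y v = scale (\<mu> y) v" by metis
  define W where "W = {u \<in> V. \<forall>y\<in>F. \<rho> y u = scale (\<mu> y) u}"
  have FG: "y \<in> carrier G" if "y \<in> F" for y using that insert.prems by blast
  have W: "subspace W"
    unfolding subspace_def W_def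
    by (auto simp: rho_zero rho_add rho_scale FG scale_right_distrib mult.commute
        subspace_0[OF subspace_V] subspace_add[OF subspace_V] subspace_scale[OF subspace_V])
  have Wx: "\<rho> x u \<in> W" if u: "u \<in> W" for u
  proof -
    have "\<rho> y (\<rho> x u) = scale (\<mu> y) (\<rho> x u)" if y: "y \<in> F" for y
      using u y rho_commute[of y x u] x FG[OF y] insert.prems(2)[of y x]
      by (simp add: W_def rho_scale)
    then show ?thesis using u x by (simp add: W_def rho_closed)
  qed
  obtain c where c: "\<forall>v\<in>V. (\<rho> x ^^ Coset.order G) v = scale c v"
    using rho_funpow_order[OF x] by blast
  define N where "N = Coset.order G"
  have N: "N > 0" unfolding N_def using finite_carrier by (simp add: order_gt_0_iff_finite)
  \<comment> \<open>The annihilating polynomial $X^N - c$, where $N = |G|$ and $c$ is the scalar $\rho(x)^N$.\<close>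
  define p where "p = monom 1 N - [:c:]"
  have coeffs: "coeff p i = (if i = N then 1 else 0) - (if i = 0 then c else 0)" for i
    by (simp add: p_def coeff_pCons split: nat.splits)
  have "coeff p N \<noteq> 0" "\<And>i. i > N \<Longrightarrow> coeff p i = 0" using N by (simp_all add: coeffs)
  then have deg: "degree p = N" and p0: "p \<noteq> 0"
    by (metis le_degree degree_le le_antisym, auto)
  have "(\<Sum>i\<le>N. scale (coeff p i) ((\<rho> x ^^ i) v)) = (\<rho> x ^^ N) v - scale c v"
  proof -
    have "scale (coeff p i) ((\<rho> x ^^ i) v) =
        (if i = N then (\<rho> x ^^ N) v else 0) - (if i = 0 then scale c v else 0)" for i
      using N by (auto simp: coeffs scale_left_diff_distrib)
    then show ?thesis by (simp add: sum_subtractf)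
  qed
  also have "\<dots> = 0" using c v(1) by (simp add: N_def)
  finally have "\<exists>u\<in>W. u \<noteq> 0 \<and> (\<exists>c. \<rho> x u = scale c u)"
    using v \<mu> W Wx x
    by (intro eigenvector_of_annihilating_polynomial[where p = p and w = v])
      (auto simp: deg p0 W_def rho_add rho_scale intro: vector_space_axioms)
  then obtain u where "u \<in> W" "u \<noteq> 0" "\<exists>c. \<rho> x u = scale c u" by blast
  then show ?case unfolding W_def by (intro bexI[of _ u]) auto
qed

text \<open>
  Let $v$ be a common eigenvector of the operators $\rho(h)$, $h \in H$, with eigenvalues $\mu(h)$.
  On $\rho(x)v$ the element $h$ acts as the scalar $\beta(h,x)\mu(h)$. Replacing $x$ within its coset
  of $H$ changes $\rho(x)v$ only by a scalar, whereas different cosets give different characters of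
  $H$, hence independent vectors. So representatives of the cosets give a basis of the irreducible
  space, and its dimension is the index of $H$.
\<close>

theorem dim_mult_card_lagrangian:
  assumes H: "lagrangian H"
  shows "dim V * card H = Coset.order G"
proof -
  note HG = lagrangian_subset[OF H] and HS = lagrangian_subgroup[OF H]
  have finH: "finite H" using HG finite_carrier by (rule finite_subset)
  have "\<exists>v\<in>V. v \<noteq> 0 \<and> (\<forall>h\<in>H. \<exists>c. \<rho> h v = scale c v)"
    by (rule common_eigenvector[OF finH HG]) (use H in \<open>auto simp: lagrangian_def\<close>)
  then obtain v \<mu> where v: "v \<in> V" "v \<noteq> 0" and \<mu>: "\<And>h. h \<in> H \<Longrightarrow> \<rho> h v = scale (\<mu> h) v" by metis
  have \<mu>0: "\<mu> h \<noteq> 0" if "h \<in> H" for h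
    using rho_eq_0_iff[of h v] \<mu>[OF that] v HG that by auto
  define R where "R = rcosets H"
  have finR: "finite R" unfolding R_def RCOSETS_def by (intro finite_UN_I finite_carrier finite.intros)
  define t where "t C = (SOME x. x \<in> C)" for C :: "'g set"
  have t: "t C \<in> C" if C: "C \<in> R" for C
  proof -
    obtain x where "x \<in> carrier G" "C = H #> x" using C unfolding R_def RCOSETS_def by blast
    then have "x \<in> C" using rcos_self[OF _ HS] by simp
    then show ?thesis unfolding t_def by (rule someI)
  qed
  have RG: "C \<subseteq> carrier G" if "C \<in> R" for C
    using that rcosets_part_G[OF HS] by (auto simp: R_def)
  have tG: "t C \<in> carrier G" if "C \<in> R" for C using t[OF that] RG[OF that] by blast
  have coset_t: "C = H #> t C" if C: "C \<in> R" for C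
  proof -
    obtain x where "x \<in> carrier G" "C = H #> x" using C unfolding R_def RCOSETS_def by blast
    then show ?thesis using repr_independence[OF _ _ HS, of "t C" x] t[OF C] by simp
  qed
  have t_eq: "t C \<otimes> inv (t D) \<in> H \<longleftrightarrow> C = D" if C: "C \<in> R" and D: "D \<in> R" for C D
  proof
    assume "t C \<otimes> inv (t D) \<in> H"
    then have "t C \<in> H #> t D"
      using tG[OF C] tG[OF D] by (auto simp: r_coset_def m_assoc intro!: bexI[of _ "t C \<otimes> inv (t D)"])
    then have "H #> t C = H #> t D"
      using repr_independence[OF _ tG[OF D] HS, of "t C"] by simp
    then show "C = D" using coset_t C D by metis
  next
    assume "C = D"
    then show "t C \<otimes> inv (t D) \<in> H" using tG[OF C] subgroup.one_closed[OF HS] by simp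
  qed
  define u where "u C = \<rho> (t C) v" for C
  have uV: "u C \<in> V" if "C \<in> R" for C using that by (simp add: u_def rho_closed tG v)
  have u0: "u C \<noteq> 0" if "C \<in> R" for C using that by (simp add: u_def rho_eq_0_iff tG v)
  have weight: "\<rho> h (u C) = scale (commutator h (t C) * \<mu> h) (u C)" if h: "h \<in> H" and C: "C \<in> R" for h C
    using rho_commute[of h "t C" v] h HG tG[OF C] v(1) by (auto simp: u_def \<mu> rho_scale)
  have coeff_0: "a D = 0" if zero: "(\<Sum>C\<in>R. scale (a C) (u C)) = 0" and D: "D \<in> R" for a D
  proof -
    \<comment> \<open>Apply to the relation the projection onto the weight space of $\rho(t_D)v$, up to the factor
      $|H|$: the average over $H$ against the inverse of that weight.\<close>
    have "0 = (\<Sum>h\<in>H. scale (commutator (t D) h / \<mu> h) (\<rho> h (\<Sum>C\<in>R. scale (a C) (u C))))"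
      using HG by (intro sum.neutral[symmetric]) (auto simp: zero rho_zero)
    also have "\<dots> = (\<Sum>h\<in>H. \<Sum>C\<in>R. scale (commutator h (t C \<otimes> inv (t D)) * a C) (u C))"
    proof (intro sum.cong refl)
      fix h assume h: "h \<in> H"
      have hG: "h \<in> carrier G" using h HG by blast
      have inv_comm: "commutator h (inv (t D)) = commutator (t D) h"
        using hG tG[OF D] by (metis commutator_inv_left commutator_swap inv_closed inverse_inverse_eq)
      have "\<rho> h (\<Sum>C\<in>R. scale (a C) (u C)) = (\<Sum>C\<in>R. scale (a C * (commutator h (t C) * \<mu> h)) (u C))"
        using hG finR uV by (simp add: rho_sum subspace_scale[OF subspace_V] rho_scale weight[OF h])
      then have "scale (commutator (t D) h / \<mu> h) (\<rho> h (\<Sum>C\<in>R. scale (a C) (u C))) =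
          (\<Sum>C\<in>R. scale (commutator (t D) h / \<mu> h * (a C * (commutator h (t C) * \<mu> h))) (u C))"
        by (simp add: scale_sum_right)
      also have "\<dots> = (\<Sum>C\<in>R. scale (commutator h (t C \<otimes> inv (t D)) * a C) (u C))"
        using hG tG D \<mu>0[OF h] inv_comm
        by (intro sum.cong refl) (simp add: commutator_mult_right mult_ac)
      finally show "scale (commutator (t D) h / \<mu> h) (\<rho> h (\<Sum>C\<in>R. scale (a C) (u C))) = \<dots>" .
    qed
    also have "\<dots> = (\<Sum>C\<in>R. scale ((\<Sum>h\<in>H. commutator h (t C \<otimes> inv (t D))) * a C) (u C))"
      by (subst sum.swap) (simp add: scale_sum_left sum_distrib_right)
    also have "\<dots> = (\<Sum>C\<in>R. if C = D then scale (of_nat (card H) * a D) (u D) else 0)"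
      using tG D by (intro sum.cong refl) (auto simp: lagrangian_sum[OF H] t_eq)
    also have "\<dots> = scale (of_nat (card H) * a D) (u D)" using finR D by simp
    finally have "of_nat (card H) * a D = 0" using u0[OF D] by simp
    moreover have "card H \<noteq> 0" using finH subgroup.one_closed[OF HS] by auto
    ultimately show ?thesis by simp
  qed
  have inj: "inj_on u R"
  proof (rule inj_onI, rule ccontr)
    fix C D assume C: "C \<in> R" and D: "D \<in> R" and eq: "u C = u D" and neq: "C \<noteq> D"
    \<comment> \<open>Two equal vectors would satisfy a relation with coefficients $1$ and $-1$.\<close>
    let ?a = "\<lambda>E. (if E = C then 1 else 0) - (if E = D then 1 else 0)"
    have *: "scale (?a E) (u E) = (if E = C then u C else 0) - (if E = D then u D else 0)" for E
      by (simp add: scale_left_diff_distrib)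
    have "(\<Sum>E\<in>R. scale (?a E) (u E)) = 0"
      unfolding * sum_subtractf using finR C D eq by simp
    from coeff_0[OF this C] show False using neq by simp
  qed
  have indep: "independent (u ` R)"
  proof
    assume "dependent (u ` R)"
    then obtain b C where "C \<in> R" "b (u C) \<noteq> 0" "(\<Sum>w\<in>u ` R. scale (b w) w) = 0"
      using finR by (auto simp: dependent_finite)
    then show False
      using coeff_0[of "\<lambda>C. b (u C)" C] by (simp add: sum.reindex[OF inj])
  qed
  let ?W = "span (u ` R)"
  have orbit: "\<rho> x v \<in> ?W" if x: "x \<in> carrier G" for x
  proof -
    define C where "C = H #> x"
    have C: "C \<in> R" using x by (auto simp: R_def RCOSETS_def C_def)
    then obtain h where h: "h \<in> H" "t C = h \<otimes> x" using t[OF C] by (auto simp: C_def r_coset_def)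
    have hG: "h \<in> carrier G" using h HG by blast
    have h': "inv h \<in> H" using h subgroup.m_inv_closed[OF HS] by blast
    have "t C \<otimes> inv h = x" using h hG x m_comm[of h x] by (simp add: m_assoc)
    then have "scale (\<omega> (t C) (inv h)) (\<rho> x v) = scale (\<mu> (inv h)) (u C)"
      using rho_mult[of "t C" "inv h" v] tG[OF C] hG v(1) \<mu>[OF h'] by (simp add: u_def rho_scale)
    then have "scale (inverse (\<omega> (t C) (inv h))) (scale (\<omega> (t C) (inv h)) (\<rho> x v)) \<in> ?W"
      using C by (simp only:) (intro span_scale span_base imageI)
    then show ?thesis using nonzero_cocycle[OF tG[OF C] inv_closed[OF hG]] by simp
  qed
  have "?W \<subseteq> V" using uV by (intro span_minimal subspace_V) auto
  moreover have "\<rho> x ` ?W \<subseteq> ?W" if x: "x \<in> carrier G" for x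
  proof -
    let ?U = "{w \<in> V. \<rho> x w \<in> ?W}"
    have "subspace ?U"
      unfolding subspace_def using x
      by (auto simp: rho_zero rho_add rho_scale span_zero span_add span_scale
        subspace_0[OF subspace_V] subspace_add[OF subspace_V] subspace_scale[OF subspace_V])
    moreover have "u C \<in> ?U" if C: "C \<in> R" for C
      using uV[OF C] orbit[of "x \<otimes> t C"] rho_mult[of x "t C" v] x tG[OF C] v
      by (auto simp: u_def intro: span_scale)
    ultimately have "?W \<subseteq> ?U" by (intro span_minimal) auto
    then show ?thesis by blast
  qed
  moreover have "?W \<noteq> {0}"
  proof -
    have C: "H #> \<one> \<in> R" by (auto simp: R_def RCOSETS_def)
    then have "u (H #> \<one>) \<in> ?W" by (intro span_base imageI)
    then show ?thesis using u0[OF C] by blast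
  qed
  ultimately have "?W = V" using irreducible[of ?W] by auto
  then have "dim V = card R"
    using dim_span_eq_card_independent[OF indep] card_image[OF inj] by simp
  then show ?thesis using lagrange[OF HS] by (simp add: R_def)
qed

text \<open>
  Combine $d\,|H| = |G|$ with $|H|^2 = |G|\,|G_0|$.
\<close>

theorem dim_squared: "dim V ^ 2 * card (regular_elements G \<omega>) = Coset.order G"
proof -
  obtain H where H: "lagrangian H" using lagrangian_exists by blast
  have pos: "Coset.order G > 0" using finite_carrier by (simp add: order_gt_0_iff_finite)
  have "dim V ^ 2 * card (regular_elements G \<omega>) * Coset.order G = (dim V * card H) ^ 2"
    by (simp add: card_lagrangian[OF H] power_mult_distrib)
  also have "\<dots> = Coset.order G * Coset.order G"
    by (simp add: dim_mult_card_lagrangian[OF H] power2_eq_square)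
  finally show ?thesis using pos by simp
qed

end

section \<open>Existence of irreducible representations\<close>

context finite_abelian_cocycle
begin

text \<open>
  Left translation of functions on $G$, twisted by the cocycle: the left regular module of the
  twisted group algebra. Functions vanish outside the carrier, so that they form a space of
  finite dimension.
\<close>

definition twisted_translation :: "'g \<Rightarrow> ('g \<Rightarrow> 'k) \<Rightarrow> 'g \<Rightarrow> 'k" where
  "twisted_translation x f =
    (\<lambda>z. if z \<in> carrier G then \<omega> x (inv x \<otimes> z) * f (inv x \<otimes> z) else 0)"

lemma twisted_regular_representation:
  "projective_representation (\<lambda>c f x. c * f x) G \<omega> {f. \<forall>x. x \<notin> carrier G \<longrightarrow> f x = 0} twisted_translation"
proof -
  let ?scale = "\<lambda>(c :: 'k) (f :: 'g \<Rightarrow> 'k) x. c * f x"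
  let ?V = "{f :: 'g \<Rightarrow> 'k. \<forall>x. x \<notin> carrier G \<longrightarrow> f x = 0}"
  interpret vector_space ?scale
    by unfold_locales (auto simp: algebra_simps)
  have V: "subspace ?V" by (auto simp: subspace_def)
  define \<delta> :: "'g \<Rightarrow> 'g \<Rightarrow> 'k" where "\<delta> x = (\<lambda>y. if y = x then 1 else 0)" for x
  have "f \<in> span (\<delta> ` carrier G)" if f: "f \<in> ?V" for f
  proof -
    have sum_apply: "(\<Sum>x\<in>A. F x) y = (\<Sum>x\<in>A. F x y)" if "finite A"
      for A y and F :: "'g \<Rightarrow> 'g \<Rightarrow> 'k"
      using that by (induction A rule: finite_induct) auto
    have "f = (\<Sum>x\<in>carrier G. ?scale (f x) (\<delta> x))"
    proof
      fix y
      have "(\<Sum>x\<in>carrier G. f x * \<delta> x y) = (\<Sum>x\<in>carrier G. if x = y then f y else 0)"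
        by (intro sum.cong) (auto simp: \<delta>_def)
      also have "\<dots> = f y" using f finite_carrier by simp
      finally show "f y = (\<Sum>x\<in>carrier G. ?scale (f x) (\<delta> x)) y"
        using finite_carrier by (simp add: sum_apply)
    qed
    also have "\<dots> \<in> span (\<delta> ` carrier G)" by (intro span_sum span_scale span_base imageI)
    finally show ?thesis .
  qed
  moreover have "span (\<delta> ` carrier G) \<subseteq> ?V" by (intro span_minimal V) (auto simp: \<delta>_def)
  ultimately have span: "?V = span (\<delta> ` carrier G)" by blast
  show ?thesis
  proof unfold_locales
    show "subspace ?V" by (rule V)
    show "\<exists>S. finite S \<and> ?V = span S" using span finite_carrier by blast
  next
    fix x assume x: "x \<in> carrier G"
    show "bij_betw (twisted_translation x) ?V ?V"
      by (rule bij_betw_byWitness[where f' = "\<lambda>f z. if z \<in> carrier G then f (x \<otimes> z) / \<omega> x z else 0"])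
        (use x in \<open>auto simp: twisted_translation_def fun_eq_iff nonzero_cocycle m_assoc[symmetric]\<close>)
  next
    fix x y f assume x: "x \<in> carrier G" and y: "y \<in> carrier G" and f: "f \<in> ?V"
    show "twisted_translation x (twisted_translation y f) = ?scale (\<omega> x y) (twisted_translation (x \<otimes> y) f)"
    proof
      fix z
      show "twisted_translation x (twisted_translation y f) z = \<omega> x y * twisted_translation (x \<otimes> y) f z"
      proof (cases "z \<in> carrier G")
        case z: True
        define w where "w = inv y \<otimes> (inv x \<otimes> z)"
        have w: "w \<in> carrier G" using x y z by (simp add: w_def)
        have "inv x \<otimes> z = y \<otimes> w" using x y z by (simp add: w_def m_assoc[symmetric])
        moreover have "inv (x \<otimes> y) \<otimes> z = w" using x y z by (simp add: w_def inv_mult_group m_assoc)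
        moreover have "inv y \<otimes> (y \<otimes> w) = w" using y w by (simp add: m_assoc[symmetric])
        ultimately show ?thesis
          using x y z w cocycle[OF x y w]
          by (simp add: twisted_translation_def w_def[symmetric] mult.assoc[symmetric] inv_mult_group)
      qed (simp add: twisted_translation_def)
    qed
  qed (auto simp: twisted_translation_def fun_eq_iff algebra_simps)
qed

theorem irreducible_representation_exists:
  "\<exists>(V :: ('g \<Rightarrow> 'k) set) \<rho>. irreducible_projective_representation (\<lambda>c f x. c * f x) G \<omega> V \<rho>"
proof -
  let ?V = "{f :: 'g \<Rightarrow> 'k. \<forall>x. x \<notin> carrier G \<longrightarrow> f x = 0}"
  interpret projective_representation "\<lambda>c f x. c * f x" G \<omega> ?V twisted_translation
    by (rule twisted_regular_representation)
  interpret abelian_projective_representation G \<omega> "\<lambda>c f x. c * f x" ?V twisted_translation ..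
  have "(\<lambda>x. if x = \<one> then 1 else 0) \<in> ?V - {0}"
    by (auto simp: fun_eq_iff)
  then have "?V \<noteq> {0}" by blast
  then show ?thesis using irreducible_subrepresentation_exists by blast
qed

end

section \<open>Counting solutions of linear congruences by the Smith normal form\<close>

text \<open>
  Dividing by $\gcd(M,s)$ turns the condition into $q \mid t$ with $q = M/\gcd(M,s)$.
\<close>

lemma card_dvd_mult_interval:
  fixes M s :: int
  assumes M: "M > 0"
  shows "card {t \<in> {0..<M}. M dvd s * t} = nat (gcd M s)"
proof -
  define q where "q = M div gcd M s"
  have Mq: "M = q * gcd M s" by (simp add: q_def)
  have g: "gcd M s > 0" using M by simp
  have q: "q > 0" using M Mq g by (metis zero_less_mult_pos2)
  have dvd: "M dvd s * t \<longleftrightarrow> q dvd t" for t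
  proof -
    obtain s' where s': "s = s' * gcd M s" by (metis dvd_def gcd_dvd2 mult.commute)
    have cop: "coprime q s'"
      using div_gcd_coprime[of M s] M g s' by (metis nonzero_mult_div_cancel_right q_def less_irrefl)
    have "M dvd s * t \<longleftrightarrow> q * gcd M s dvd (s' * t) * gcd M s"
      using Mq s' by (metis mult.assoc mult.commute)
    also have "\<dots> \<longleftrightarrow> q dvd s' * t"
      using g dvd_mult_cancel_right[of q "gcd M s" "s' * t"] by (metis less_irrefl)
    also have "\<dots> \<longleftrightarrow> q dvd t" using cop by (simp add: coprime_dvd_mult_right_iff)
    finally show ?thesis .
  qed
  have "{t \<in> {0..<M}. M dvd s * t} = (\<lambda>k. q * k) ` {0..<gcd M s}"
  proof (intro equalityI subsetI)
    fix t assume "t \<in> {t \<in> {0..<M}. M dvd s * t}"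
    then have t: "0 \<le> t" "t < M" "q dvd t" by (auto simp: dvd)
    then obtain k where k: "t = q * k" by blast
    have "0 \<le> k" using t(1) k q by (simp add: zero_le_mult_iff)
    moreover have "k < gcd M s" using t(2) k q Mq by (metis mult_less_cancel_left_pos)
    ultimately show "t \<in> (\<lambda>k. q * k) ` {0..<gcd M s}" using k by auto
  next
    fix t assume "t \<in> (\<lambda>k. q * k) ` {0..<gcd M s}"
    then obtain k where "t = q * k" "k \<in> {0..<gcd M s}" by blast
    then have k: "t = q * k" "0 \<le> k" "k < gcd M s" by auto
    then have "t < M" using q Mq by (metis mult_less_cancel_left_pos)
    then show "t \<in> {t \<in> {0..<M}. M dvd s * t}" using k q by (auto simp: dvd)
  qed
  then show ?thesis using q by (simp add: card_image inj_on_def)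
qed

lemma card_residue_class_interval:
  fixes M m c :: int
  assumes m: "m > 0" and M: "m dvd M" "M > 0" and c: "0 \<le> c" "c < m"
  shows "card {t \<in> {0..<M}. t mod m = c} = nat (M div m)"
proof -
  have "{t \<in> {0..<M}. t mod m = c} = (\<lambda>k. c + m * k) ` {0..<M div m}"
  proof (intro equalityI subsetI)
    fix t assume "t \<in> {t \<in> {0..<M}. t mod m = c}"
    then have t: "0 \<le> t" "t < M" "t mod m = c" by auto
    have "m * (t div m) \<le> t" using m by (metis mult_div_mod_eq pos_mod_sign le_add_same_cancel1)
    then have "m * (t div m) < m * (M div m)" using t(2) M(1) by simp
    then have "t div m < M div m" using m by simp
    moreover have "t = c + m * (t div m)" using t(3) by (metis mult.commute mod_mult_div_eq add.commute)
    ultimately show "t \<in> (\<lambda>k. c + m * k) ` {0..<M div m}"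
      using t(1) m by (intro image_eqI[of _ _ "t div m"]) (auto simp: pos_imp_zdiv_nonneg_iff)
  next
    fix t assume "t \<in> (\<lambda>k. c + m * k) ` {0..<M div m}"
    then obtain k where "t = c + m * k" "k \<in> {0..<M div m}" by blast
    then have k: "t = c + m * k" "0 \<le> k" "k < M div m" by auto
    have "m * (k + 1) \<le> m * (M div m)" using k m by simp
    then have "t < M" using c k(1) M by (simp add: algebra_simps)
    then show "t \<in> {t \<in> {0..<M}. t mod m = c}" using k m c by auto
  qed
  then show ?thesis using m by (simp add: card_image inj_on_def)
qed

text \<open>
  The solutions of $Af \equiv 0$ in $(\mathbb{Z}/M)^n$, represented by their residues in $[0,M)$.
\<close>

definition congruence_solutions :: "nat \<Rightarrow> int \<Rightarrow> int mat \<Rightarrow> (nat \<Rightarrow> int) set" where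
  "congruence_solutions n M A =
    {f \<in> {..<n} \<rightarrow>\<^sub>E {0..<M}. \<forall>i<n. M dvd (A *\<^sub>v vec n f) $ i}"

lemma finite_congruence_solutions [simp]: "finite (congruence_solutions n M A)"
  unfolding congruence_solutions_def by (rule finite_subset[of _ "{..<n} \<rightarrow>\<^sub>E {0..<M}"]) (auto intro: finite_PiE)

lemma dvd_mult_mat_vec:
  fixes A :: "int mat"
  assumes "A \<in> carrier_mat n n" "v \<in> carrier_vec n" "\<forall>i<n. M dvd v $ i" "i < n"
  shows "M dvd (A *\<^sub>v v) $ i"
  using assms by (auto simp: scalar_prod_def intro!: dvd_sum)

lemma dvd_mult_mat_vec_cong:
  fixes A :: "int mat"
  assumes A: "A \<in> carrier_mat n n" and v: "v \<in> carrier_vec n" and w: "w \<in> carrier_vec n"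
    and vw: "\<forall>i<n. M dvd v $ i - w $ i" and i: "i < n"
  shows "M dvd (A *\<^sub>v v) $ i - (A *\<^sub>v w) $ i"
proof -
  have "M dvd (A *\<^sub>v (v - w)) $ i"
    using v w vw i by (intro dvd_mult_mat_vec[OF A]) auto
  then show ?thesis using A v w i by (simp add: mult_minus_distrib_mat_vec)
qed

lemma congruence_solutions_subset_mult_left:
  assumes P: "P \<in> carrier_mat n n" and A: "A \<in> carrier_mat n n"
  shows "congruence_solutions n M A \<subseteq> congruence_solutions n M (P * A)"
proof
  fix f assume f: "f \<in> congruence_solutions n M A"
  have "M dvd (P * A *\<^sub>v vec n f) $ i" if "i < n" for i
  proof -
    have "M dvd (P *\<^sub>v (A *\<^sub>v vec n f)) $ i"
      by (rule dvd_mult_mat_vec[OF P _ _ that])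
        (use A f in \<open>auto simp: congruence_solutions_def simp del: index_mult_mat_vec\<close>)
    then show ?thesis using assoc_mult_mat_vec[OF P A, of "vec n f"] by simp
  qed
  then show "f \<in> congruence_solutions n M (P * A)"
    using f by (simp add: congruence_solutions_def)
qed

lemma invertible_mat_inverse:
  assumes "P \<in> carrier_mat n n" "invertible_mat P"
  obtains P' where "P' \<in> carrier_mat n n" "P * P' = 1\<^sub>m n" "P' * P = 1\<^sub>m n"
proof -
  obtain P' where P': "inverts_mat P P'" "inverts_mat P' P" using assms unfolding invertible_mat_def by blast
  have 1: "P * P' = 1\<^sub>m n" and 2: "P' * P = 1\<^sub>m (dim_row P')"
    using P' assms by (auto simp: inverts_mat_def)
  have "dim_col P' = n" using arg_cong[OF 1, of dim_col] by simp
  moreover have "dim_row P' = n" using arg_cong[OF 2, of dim_col] assms by simp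
  ultimately show thesis using that[of P'] 1 2 by auto
qed

text \<open>
  Reduction of $Qf$ modulo $M$ maps solutions for $AQ$ to solutions for $A$. A left inverse of $Q$
  makes this map injective; an integral one is needed, since the argument is modulo $M$.
\<close>

lemma card_congruence_solutions_mult_right_le:
  assumes A: "A \<in> carrier_mat n n" and Q: "Q \<in> carrier_mat n n" and Q': "Q' \<in> carrier_mat n n"
    and inv: "Q' * Q = 1\<^sub>m n" and M: "M > 0"
  shows "card (congruence_solutions n M (A * Q)) \<le> card (congruence_solutions n M A)"
proof (rule card_inj_on_le)
  define \<phi> where "\<phi> f = (\<lambda>i\<in>{..<n}. (Q *\<^sub>v vec n f) $ i mod M)" for f
  have \<phi>: "\<forall>i<n. M dvd vec n (\<phi> f) $ i - (Q *\<^sub>v vec n f) $ i" for f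
    by (simp add: \<phi>_def mod_eq_dvd_iff[symmetric] del: index_mult_mat_vec)
  show "finite (congruence_solutions n M A)" by simp
  show "\<phi> ` congruence_solutions n M (A * Q) \<subseteq> congruence_solutions n M A"
  proof (intro image_subsetI)
    fix f assume f: "f \<in> congruence_solutions n M (A * Q)"
    have "M dvd (A *\<^sub>v vec n (\<phi> f)) $ i" if i: "i < n" for i
    proof -
      have "M dvd (A *\<^sub>v vec n (\<phi> f)) $ i - (A *\<^sub>v (Q *\<^sub>v vec n f)) $ i"
        by (rule dvd_mult_mat_vec_cong[OF A _ _ \<phi> i]) (use Q in auto)
      moreover have "M dvd (A *\<^sub>v (Q *\<^sub>v vec n f)) $ i"
        using f i assoc_mult_mat_vec[OF A Q, of "vec n f"] by (simp add: congruence_solutions_def)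
      ultimately show ?thesis by (metis diff_add_cancel dvd_add)
    qed
    then show "\<phi> f \<in> congruence_solutions n M A"
      using M by (auto simp: congruence_solutions_def \<phi>_def)
  qed
  show "inj_on \<phi> (congruence_solutions n M (A * Q))"
  proof (rule inj_onI)
    fix f h assume f: "f \<in> congruence_solutions n M (A * Q)" and h: "h \<in> congruence_solutions n M (A * Q)"
      and eq: "\<phi> f = \<phi> h"
    have "\<forall>i<n. M dvd (Q *\<^sub>v vec n f) $ i - (Q *\<^sub>v vec n h) $ i"
    proof (intro allI impI)
      fix i assume "i < n"
      then show "M dvd (Q *\<^sub>v vec n f) $ i - (Q *\<^sub>v vec n h) $ i"
        using fun_cong[OF eq, of i] by (simp add: \<phi>_def mod_eq_dvd_iff del: index_mult_mat_vec)
    qed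
    then have "M dvd (Q' *\<^sub>v (Q *\<^sub>v vec n f)) $ i - (Q' *\<^sub>v (Q *\<^sub>v vec n h)) $ i" if "i < n" for i
      using Q that by (intro dvd_mult_mat_vec_cong[OF Q']) auto
    moreover have "Q' *\<^sub>v (Q *\<^sub>v vec n u) = vec n u" for u
      using assoc_mult_mat_vec[OF Q' Q, of "vec n u"] by (simp add: inv)
    ultimately have "M dvd f i - h i" if "i < n" for i using that by simp
    then have "f i mod M = h i mod M" if "i < n" for i using that by (simp add: mod_eq_dvd_iff)
    moreover have fh: "f \<in> {..<n} \<rightarrow>\<^sub>E {0..<M}" "h \<in> {..<n} \<rightarrow>\<^sub>E {0..<M}"
      using f h by (auto simp: congruence_solutions_def)
    ultimately have "f i = h i" if "i < n" for i
      using that PiE_mem[OF fh(1), of i] PiE_mem[OF fh(2), of i]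
      by (metis atLeastLessThan_iff lessThan_iff mod_pos_pos_trivial)
    then show "f = h" by (intro PiE_ext[OF fh]) auto
  qed
qed

text \<open>
  Each of the inequalities for $P$ and $Q$ can be applied to the inverse matrices as well.
\<close>

lemma card_congruence_solutions_equivalent:
  assumes A: "A \<in> carrier_mat n n"
    and P: "P \<in> carrier_mat n n" "invertible_mat P"
    and Q: "Q \<in> carrier_mat n n" "invertible_mat Q" and M: "M > 0"
  shows "card (congruence_solutions n M (P * A * Q)) = card (congruence_solutions n M A)"
proof -
  obtain P' where P': "P' \<in> carrier_mat n n" "P' * P = 1\<^sub>m n"
    using invertible_mat_inverse[OF P] by blast
  obtain Q' where Q': "Q' \<in> carrier_mat n n" "Q' * Q = 1\<^sub>m n" "Q * Q' = 1\<^sub>m n"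
    using invertible_mat_inverse[OF Q] by blast
  have PA: "P * A \<in> carrier_mat n n" using P A by simp
  have "P' * (P * A) = A"
    using assoc_mult_mat[OF P'(1) P(1) A] left_mult_one_mat[OF A] by (simp add: P'(2))
  then have left: "congruence_solutions n M (P * A) = congruence_solutions n M A"
    using congruence_solutions_subset_mult_left[OF P(1) A] congruence_solutions_subset_mult_left[OF P'(1) PA]
    by (metis subset_antisym)
  have "P * A * Q * Q' = P * A"
    using assoc_mult_mat[OF PA Q(1) Q'(1)] right_mult_one_mat[OF PA] by (simp add: Q'(3))
  then have "card (congruence_solutions n M (P * A)) \<le> card (congruence_solutions n M (P * A * Q))"
    using card_congruence_solutions_mult_right_le[of "P * A * Q" n Q' Q M] PA Q Q' M by simp
  moreover have "card (congruence_solutions n M (P * A * Q)) \<le> card (congruence_solutions n M (P * A))"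
    using card_congruence_solutions_mult_right_le[OF PA Q(1) Q'(1,2) M] .
  ultimately show ?thesis by (simp add: left)
qed

text \<open>
  For a diagonal matrix the system consists of independent congruences $s_i f_i \equiv 0$.
\<close>

lemma card_congruence_solutions_diagonal:
  assumes S: "S \<in> carrier_mat n n" "diagonal_mat S" and M: "M > 0"
  shows "card (congruence_solutions n M S) = (\<Prod>i<n. nat (gcd M (S $$ (i, i))))"
proof -
  have entry: "(S *\<^sub>v vec n f) $ i = S $$ (i, i) * f i" if i: "i < n" for f i
  proof -
    have "(S *\<^sub>v vec n f) $ i = (\<Sum>j<n. S $$ (i, j) * f j)"
      using S i by (auto simp: scalar_prod_def atLeast0LessThan)
    also have "\<dots> = (\<Sum>j<n. if j = i then S $$ (i, i) * f i else 0)"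
      using S i by (intro sum.cong) (auto simp: diagonal_mat_def)
    finally show ?thesis using i by simp
  qed
  have "congruence_solutions n M S = (\<Pi>\<^sub>E i\<in>{..<n}. {t \<in> {0..<M}. M dvd S $$ (i, i) * t})"
  proof -
    have dvd: "(\<forall>i<n. M dvd (S *\<^sub>v vec n f) $ i) \<longleftrightarrow> (\<forall>i<n. M dvd S $$ (i, i) * f i)" for f
      by (intro all_cong1 imp_cong refl) (simp only: entry)
    show ?thesis
      by (intro Set.set_eqI)
        (simp only: congruence_solutions_def dvd mem_Collect_eq PiE_iff Ball_def lessThan_iff, blast)
  qed
  then show ?thesis
    by (simp add: card_PiE card_dvd_mult_interval[OF M] del: atLeastLessThan_iff)
qed

lemma card_congruence_solutions_smith:
  assumes A: "A \<in> carrier_mat n n" and S: "smith_normal_form A S" and M: "M > 0"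
  shows "card (congruence_solutions n M A) = (\<Prod>i<n. nat (gcd M (S $$ (i, i))))"
proof -
  obtain P Q where "S = P * A * Q" "P \<in> carrier_mat n n" "invertible_mat P"
    "Q \<in> carrier_mat n n" "invertible_mat Q" "S \<in> carrier_mat n n" "diagonal_mat S"
    using A S unfolding smith_normal_form_def by auto
  then show ?thesis
    using card_congruence_solutions_equivalent[OF A, of P Q M] card_congruence_solutions_diagonal[of S n M] M
    by simp
qed

section \<open>Coordinates on a product of cyclic groups\<close>

text \<open>
  The generator $g_r$ is an arbitrary generator of the $r$-th factor, so its $r$-th component is
  some unit modulo $m_r$. Passing to exponents means dividing by that unit.
\<close>

locale cyclic_product_generators =
  fixes l :: nat and m :: "nat \<Rightarrow> nat" and g :: "nat \<Rightarrow> nat \<Rightarrow> int"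
  assumes m_pos: "\<And>r. r \<in> {1..l} \<Longrightarrow> m r \<ge> 1"
    and g: "\<And>r. r \<in> {1..l} \<Longrightarrow>
      g r \<in> carrier (cyclic_product l m) \<and> generate (cyclic_product l m) {g r} = cyclic_factor l m r"
begin

abbreviation G :: "(nat \<Rightarrow> int) monoid" where "G \<equiv> cyclic_product l m"

lemma carrier_G: "carrier G = (\<Pi>\<^sub>E r\<in>{1..l}. {0..<int (m r)})"
  unfolding cyclic_product_def carrier_product_group
  by (rule PiE_cong) (use m_pos in \<open>fastforce simp: carrier_integer_mod_group\<close>)

lemma mult_G: "x \<otimes>\<^bsub>G\<^esub> y = (\<lambda>r\<in>{1..l}. (x r + y r) mod int (m r))"
  by (simp add: cyclic_product_def)

lemma one_G: "\<one>\<^bsub>G\<^esub> = (\<lambda>r\<in>{1..l}. 0)"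
  by (simp add: cyclic_product_def)

lemma comm_group_G: "comm_group G"
proof -
  have "group G" unfolding cyclic_product_def by (rule product_group) simp
  then show ?thesis
    by (rule group.group_comm_groupI) (simp add: mult_G add.commute)
qed

lemma finite_carrier_G: "finite (carrier G)"
  unfolding carrier_G by (intro finite_PiE) auto

lemma order_G: "Coset.order G = (\<Prod>r\<in>{1..l}. m r)"
  unfolding Coset.order_def carrier_G by (simp add: card_PiE)

lemma carrier_G_bounds: "\<lbrakk>x \<in> carrier G; r \<in> {1..l}\<rbrakk> \<Longrightarrow> 0 \<le> x r \<and> x r < int (m r)"
  unfolding carrier_G by (metis PiE_mem atLeastLessThan_iff)

lemma G_ext: "\<lbrakk>x \<in> carrier G; y \<in> carrier G; \<And>r. r \<in> {1..l} \<Longrightarrow> x r = y r\<rbrakk> \<Longrightarrow> x = y"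
  unfolding carrier_G by (rule PiE_ext)

lemma pow_G_apply:
  fixes n :: nat
  assumes x: "x \<in> carrier G" and s: "s \<in> {1..l}"
  shows "(x [^]\<^bsub>G\<^esub> n) s = (int n * x s) mod int (m s)"
proof -
  interpret comm_group G by (rule comm_group_G)
  show ?thesis
    using s by (induction n) (simp_all add: one_G mult_G mod_simps algebra_simps)
qed

lemma finprod_G_apply:
  assumes s: "s \<in> {1..l}" and "finite A" "f \<in> A \<rightarrow> carrier G"
  shows "(\<Otimes>\<^bsub>G\<^esub>r\<in>A. f r) s = (\<Sum>r\<in>A. f r s) mod int (m s)"
proof -
  interpret comm_group G by (rule comm_group_G)
  show ?thesis
    using assms(2,3)
  proof (induction A rule: finite_induct)
    case empty
    then show ?case using s by (simp add: one_G)
  next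
    case (insert r A)
    then have "(\<Otimes>\<^bsub>G\<^esub>r\<in>insert r A. f r) = f r \<otimes>\<^bsub>G\<^esub> (\<Otimes>\<^bsub>G\<^esub>r\<in>A. f r)"
      by (intro finprod_insert) auto
    then show ?case using s insert by (simp add: mult_G mod_simps)
  qed
qed

definition element :: "(nat \<Rightarrow> nat) \<Rightarrow> nat \<Rightarrow> int" where
  "element i = (\<Otimes>\<^bsub>G\<^esub>r\<in>{1..l}. g r [^]\<^bsub>G\<^esub> i r)"

lemma element_closed: "element i \<in> carrier G"
proof -
  interpret comm_group G by (rule comm_group_G)
  show ?thesis unfolding element_def using g by (intro finprod_closed) auto
qed

lemma g_off_diagonal:
  assumes "r \<in> {1..l}" "s \<in> {1..l}" "s \<noteq> r"
  shows "g r s = 0"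
proof -
  have "g r \<in> cyclic_factor l m r"
    using g[OF assms(1)] generate.incl[of "g r" "{g r}" G] by simp
  then show ?thesis using assms by (auto simp: cyclic_factor_def)
qed

lemma element_apply:
  assumes s: "s \<in> {1..l}"
  shows "element i s = (int (i s) * g s s) mod int (m s)"
proof -
  interpret comm_group G by (rule comm_group_G)
  have "element i s = (\<Sum>r\<in>{1..l}. (g r [^]\<^bsub>G\<^esub> i r) s) mod int (m s)"
    unfolding element_def using g by (intro finprod_G_apply s) auto
  also have "(\<Sum>r\<in>{1..l}. (g r [^]\<^bsub>G\<^esub> i r) s) =
      (\<Sum>r\<in>{1..l}. if r = s then (int (i s) * g s s) mod int (m s) else 0)"
    using s g g_off_diagonal[of _ s] by (intro sum.cong refl) (auto simp: pow_G_apply)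
  finally show ?thesis using s by simp
qed

text \<open>
  The element with component $1$ in the $r$-th factor is a power of $g_r$. The right-hand side is
  reduced modulo $m_r$ to cover the trivial factor $m_r = 1$.
\<close>

lemma g_diagonal_invertible:
  assumes r: "r \<in> {1..l}"
  shows "\<exists>w. (w * g r r) mod int (m r) = 1 mod int (m r)"
proof -
  interpret comm_group G by (rule comm_group_G)
  define e where "e = (\<lambda>s\<in>{1..l}. if s = r then 1 mod int (m r) else 0)"
  have "e \<in> carrier G" unfolding carrier_G e_def using m_pos by fastforce
  then have "e \<in> generate G {g r}"
    using g[OF r] by (auto simp: cyclic_factor_def e_def)
  then obtain k :: nat where "e = g r [^]\<^bsub>G\<^esub> k"
    using generate_pow_on_finite_carrier[OF finite_carrier_G, of "g r"] g[OF r] by blast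
  then have "e r = (int k * g r r) mod int (m r)"
    using pow_G_apply[of "g r" r k] g[OF r] r by simp
  then have "1 mod int (m r) = (int k * g r r) mod int (m r)"
    using r by (simp add: e_def)
  then show ?thesis by metis
qed

definition coord_unit :: "nat \<Rightarrow> int" where
  "coord_unit r = (SOME w. (w * g r r) mod int (m r) = 1 mod int (m r))"

text \<open>
  The exponent of $g_r$ in $x$, reduced to the range $[0,m_r)$; see \<open>element_coord\<close>.
\<close>

definition coord :: "(nat \<Rightarrow> int) \<Rightarrow> nat \<Rightarrow> int" where
  "coord x r = (coord_unit r * x r) mod int (m r)"

lemma coord_unit: "r \<in> {1..l} \<Longrightarrow> [coord_unit r * g r r = 1] (mod int (m r))"
  unfolding coord_unit_def cong_def by (rule someI_ex) (rule g_diagonal_invertible)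

lemma coord_bounds: "r \<in> {1..l} \<Longrightarrow> 0 \<le> coord x r \<and> coord x r < int (m r)"
  using m_pos[of r] by (simp add: coord_def)

lemma coord_element:
  assumes r: "r \<in> {1..l}"
  shows "coord (element i) r = int (i r) mod int (m r)"
proof -
  have "[coord_unit r * (int (i r) * g r r) = int (i r) * (coord_unit r * g r r)] (mod int (m r))"
    by (simp add: mult_ac)
  also have "[int (i r) * (coord_unit r * g r r) = int (i r) * 1] (mod int (m r))"
    by (intro cong_mult cong_refl coord_unit r)
  finally show ?thesis
    by (simp add: coord_def element_apply[OF r] cong_def mod_simps)
qed

lemma element_coord:
  assumes x: "x \<in> carrier G"
  shows "element (\<lambda>r. nat (coord x r)) = x"
proof (rule G_ext[OF element_closed x])
  fix r assume r: "r \<in> {1..l}"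
  have "[coord_unit r * x r * g r r = x r * (coord_unit r * g r r)] (mod int (m r))"
    by (simp add: mult_ac)
  also have "[x r * (coord_unit r * g r r) = x r * 1] (mod int (m r))"
    by (intro cong_mult cong_refl coord_unit r)
  finally show "element (\<lambda>r. nat (coord x r)) r = x r"
    using coord_bounds[OF r, of x] carrier_G_bounds[OF x r]
    by (simp add: element_apply[OF r] coord_def cong_def mod_simps)
qed

lemma coord_inject:
  assumes "x \<in> carrier G" "y \<in> carrier G" and eq: "\<And>r. r \<in> {1..l} \<Longrightarrow> coord x r = coord y r"
  shows "x = y"
proof -
  have "element (\<lambda>r. nat (coord x r)) = element (\<lambda>r. nat (coord y r))"
    by (rule G_ext[OF element_closed element_closed]) (simp add: element_apply eq)
  then show ?thesis using assms by (simp add: element_coord)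
qed

lemma coord_mult:
  assumes r: "r \<in> {1..l}"
  shows "int (m r) dvd coord (x \<otimes>\<^bsub>G\<^esub> y) r - (coord x r + coord y r)"
  using r by (simp add: coord_def mult_G mod_eq_dvd_iff[symmetric] mod_simps algebra_simps)

end

section \<open>Regular elements as the kernel of the matrix of the cocycle\<close>

lemma primitive_root_power_int_eq_1_iff:
  assumes z: "primitive_root_of_unity n z"
  shows "z powi k = 1 \<longleftrightarrow> int n dvd k"
proof -
  have n: "n > 0" "z ^ n = 1" and min: "\<And>j. 0 < j \<Longrightarrow> j < n \<Longrightarrow> z ^ j \<noteq> 1"
    using z by (auto simp: primitive_root_of_unity_def)
  have z0: "z \<noteq> 0" using n by (metis power_0_left less_not_refl zero_neq_one)
  define j where "j = nat (k mod int n)"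
  have j: "k mod int n = int j" "j < n" using n(1) by (auto simp: j_def nat_less_iff)
  have "z powi k = z powi (int n * (k div int n) + int j)" using j(1) by (metis mult_div_mod_eq)
  also have "\<dots> = (z powi int n) powi (k div int n) * z powi int j"
    by (simp only: power_int_add[OF disjI1[OF z0]] power_int_mult)
  also have "\<dots> = z ^ j" using n(2) by simp
  finally have "z powi k = 1 \<longleftrightarrow> j = 0" using min[of j] j(2) by (cases "j = 0") auto
  then show ?thesis using j(1) by (simp add: dvd_eq_mod_eq_0)
qed

lemma primitive_root_power_int_eq_iff:
  assumes z: "primitive_root_of_unity n z"
  shows "z powi k = z powi j \<longleftrightarrow> int n dvd k - j"
proof -
  have "z \<noteq> 0" using z by (auto simp: primitive_root_of_unity_def power_0_left)
  then have "z powi k = z powi j \<longleftrightarrow> z powi (k - j) = 1"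
    by (simp add: power_int_diff)
  then show ?thesis by (simp add: primitive_root_power_int_eq_1_iff[OF z])
qed

lemma prod_power_int:
  fixes z :: "'a::field"
  assumes "z \<noteq> 0"
  shows "(\<Prod>x\<in>A. z powi f x) = z powi (\<Sum>x\<in>A. f x)"
  using assms by (induction A rule: infinite_finite_induct) (auto simp: power_int_add)

text \<open>
  The cocycle is only prescribed on products of powers of the generators with exponents in
  $[0,m_r)$. Since every element of $G$ is such a product, this determines it on all of $G$.
\<close>

locale cyclic_product_cocycle = cyclic_product_generators +
  fixes \<zeta> :: "nat \<Rightarrow> 'k::field" and a :: "nat \<Rightarrow> nat \<Rightarrow> int"
    and \<omega> :: "(nat \<Rightarrow> int) \<Rightarrow> (nat \<Rightarrow> int) \<Rightarrow> 'k"
  assumes l: "l \<ge> 1"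
    and m_dvd: "\<And>r. r \<in> {1..<l} \<Longrightarrow> m r dvd m (Suc r)"
    and zeta_prim: "\<And>r. r \<in> {1..l} \<Longrightarrow> primitive_root_of_unity (m r) (\<zeta> (m r))"
    and zeta_compat: "\<And>r. r \<in> {1..l} \<Longrightarrow> \<zeta> (m r) = \<zeta> (m l) ^ (m l div m r)"
    and omega: "\<And>i j :: nat \<Rightarrow> nat.
       (\<And>r. r \<in> {1..l} \<Longrightarrow> i r < m r \<and> j r < m r) \<Longrightarrow>
       \<omega> (\<Otimes>\<^bsub>G\<^esub>r\<in>{1..l}. g r [^]\<^bsub>G\<^esub> i r) (\<Otimes>\<^bsub>G\<^esub>r\<in>{1..l}. g r [^]\<^bsub>G\<^esub> j r) =
         (\<Prod>(r, s)\<in>{(r, s). 1 \<le> r \<and> r < s \<and> s \<le> l}.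
            \<zeta> (m r) powi (- (a r s * int (i s) * int (j r))))"
begin

abbreviation M :: int where "M \<equiv> int (m l)"

abbreviation B :: "int mat" where "B \<equiv> B_matrix l m a"

text \<open>
  The strictly upper triangular part of $B$; $B$ is the difference of this matrix and its
  transpose.
\<close>

definition upper :: "nat \<Rightarrow> nat \<Rightarrow> int" where
  "upper i j = (if i < j then int (m l div m (Suc i)) * a (Suc i) (Suc j) else 0)"

text \<open>
  The bilinear form that describes the cocycle on coordinate vectors:
  $\omega(x,y) = \zeta_{m_l}^{-\mathrm{form}(c(x), c(y))}$. The first argument goes with the column
  index, as in the exponents $i_s j_r$ with $r < s$.
\<close>

definition form :: "(nat \<Rightarrow> int) \<Rightarrow> (nat \<Rightarrow> int) \<Rightarrow> int" where
  "form v w = (\<Sum>i<l. \<Sum>j<l. upper i j * v j * w i)"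

text \<open>
  Shifts the index range from $\{1..l\}$ to $\{0..<l\}$, the one used for matrices.
\<close>

definition coords :: "(nat \<Rightarrow> int) \<Rightarrow> nat \<Rightarrow> int" where
  "coords x i = coord x (Suc i)"

lemma m_dvd_mono:
  assumes "1 \<le> r" "r \<le> s" "s \<le> l"
  shows "m r dvd m s"
  using assms(2)
proof (induction s rule: dec_induct)
  case (step n)
  then show ?case using m_dvd[of n] assms by (auto intro: dvd_trans)
qed simp

lemma M_pos: "M > 0" using m_pos[of l] l by simp

lemma B_carrier: "B \<in> carrier_mat l l"
  by (simp add: B_matrix_def)

lemma B_entry: "\<lbrakk>i < l; j < l\<rbrakk> \<Longrightarrow> B $$ (i, j) = upper i j - upper j i"
  by (simp add: B_matrix_def upper_def)

text \<open>
  The factor $m_l/m_i$ in $b_{ij}$ makes $m_i b_{ij}$ a multiple of $m_l$; since $m_i \mid m_j$ for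
  $i < j$, the same holds for $m_j b_{ij}$. For this reason the form is well defined modulo $m_l$
  on coordinates that are only known modulo the $m_i$.
\<close>

lemma dvd_upper:
  assumes "i < l" "j < l"
  shows "M dvd upper i j * int (m (Suc i))" "M dvd upper i j * int (m (Suc j))"
proof -
  have "m (Suc i) dvd m l" using assms by (intro m_dvd_mono) auto
  then have M: "M = int (m l div m (Suc i)) * int (m (Suc i))"
    by (metis dvd_div_mult_self of_nat_mult)
  show 1: "M dvd upper i j * int (m (Suc i))"
    by (subst M) (auto simp: upper_def)
  have "upper i j = 0 \<or> int (m (Suc i)) dvd int (m (Suc j))"
    using assms m_dvd_mono[of "Suc i" "Suc j"] by (auto simp: upper_def)
  then show "M dvd upper i j * int (m (Suc j))"
    using 1 by (auto intro: dvd_trans mult_dvd_mono)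
qed

lemma dvd_mult_multiple: "M dvd u * d" if "M dvd u * n" "n dvd d" for u n d :: int
  using that by (meson dvd_refl dvd_trans mult_dvd_mono)

lemma dvd_form_diff_left:
  assumes "\<And>i. i < l \<Longrightarrow> int (m (Suc i)) dvd v i - v' i"
  shows "M dvd form v w - form v' w"
proof -
  have "form v w - form v' w = (\<Sum>i<l. \<Sum>j<l. upper i j * (v j - v' j) * w i)"
    by (simp add: form_def sum_subtractf[symmetric] algebra_simps)
  also have "M dvd \<dots>"
    by (intro dvd_sum dvd_mult2[of _ "upper _ _ * (v _ - v' _)"] dvd_mult_multiple[OF dvd_upper(2)])
      (use assms in auto)
  finally show ?thesis .
qed

lemma dvd_form_diff_right:
  assumes "\<And>i. i < l \<Longrightarrow> int (m (Suc i)) dvd w i - w' i"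
  shows "M dvd form v w - form v w'"
proof -
  have "form v w - form v w' = (\<Sum>i<l. \<Sum>j<l. upper i j * (w i - w' i) * v j)"
    by (simp add: form_def sum_subtractf[symmetric] algebra_simps)
  also have "M dvd \<dots>"
    by (intro dvd_sum dvd_mult2[of _ "upper _ _ * (w _ - w' _)"] dvd_mult_multiple[OF dvd_upper(1)])
      (use assms in auto)
  finally show ?thesis .
qed

text \<open>
  Antisymmetrizing the form gives the matrix $B$: this is the exponent of the commutator.
\<close>

lemma form_antisymmetrized:
  "form w v - form v w = - (\<Sum>i<l. w i * (B *\<^sub>v vec l v) $ i)"
proof -
  have entry: "(B *\<^sub>v vec l v) $ i = (\<Sum>j<l. (upper i j - upper j i) * v j)" if "i < l" for i
    using that B_carrier by (auto simp: scalar_prod_def atLeast0LessThan B_entry intro!: sum.cong)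
  have "form w v = (\<Sum>i<l. \<Sum>j<l. upper j i * w i * v j)"
    unfolding form_def by (subst sum.swap) simp
  then have "form w v - form v w = (\<Sum>i<l. \<Sum>j<l. upper j i * w i * v j - upper i j * v j * w i)"
    by (simp add: form_def sum_subtractf)
  also have "\<dots> = (\<Sum>i<l. - (w i * (B *\<^sub>v vec l v) $ i))"
    by (intro sum.cong refl)
      (simp add: entry sum_distrib_left sum_negf[symmetric] algebra_simps del: index_mult_mat_vec)
  finally show ?thesis by (simp add: sum_negf del: index_mult_mat_vec)
qed

lemma zeta_nonzero: "\<zeta> (m l) \<noteq> 0"
  using zeta_prim[of l] l by (auto simp: primitive_root_of_unity_def power_0_left)

lemma omega_eq_form:
  assumes x: "x \<in> carrier G" and y: "y \<in> carrier G"
  shows "\<omega> x y = \<zeta> (m l) powi (- form (coords x) (coords y))"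
proof -
  let ?P = "{(r, s). 1 \<le> r \<and> r < s \<and> s \<le> l}"
  let ?Q = "{(i, j). i < j \<and> j < l}"
  have "\<omega> x y = \<omega> (element (\<lambda>r. nat (coord x r))) (element (\<lambda>r. nat (coord y r)))"
    by (simp add: element_coord x y)
  also have "\<dots> = (\<Prod>(r, s)\<in>?P. \<zeta> (m r) powi (- (a r s * int (nat (coord x s)) * int (nat (coord y r)))))"
    unfolding element_def by (rule omega) (use coord_bounds in \<open>auto simp: nat_less_iff\<close>)
  also have "\<dots> = (\<Prod>(r, s)\<in>?P. \<zeta> (m l) powi (- (int (m l div m r) * a r s * coord x s * coord y r)))"
  proof (intro prod.cong refl, clarify)
    fix r s assume rs: "1 \<le> r" "r < s" "s \<le> l"
    then have "\<zeta> (m r) = \<zeta> (m l) powi int (m l div m r)"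
      using zeta_compat[of r] by simp
    then have "\<zeta> (m r) powi k = \<zeta> (m l) powi (int (m l div m r) * k)" for k
      by (simp only: power_int_mult)
    then show "\<zeta> (m r) powi (- (a r s * int (nat (coord x s)) * int (nat (coord y r)))) =
        \<zeta> (m l) powi (- (int (m l div m r) * a r s * coord x s * coord y r))"
      using coord_bounds[of s x] coord_bounds[of r y] rs
      by (simp add: mult.assoc)
  qed
  also have "\<dots> = \<zeta> (m l) powi (\<Sum>(r, s)\<in>?P. - (int (m l div m r) * a r s * coord x s * coord y r))"
    unfolding case_prod_unfold by (rule prod_power_int[OF zeta_nonzero])
  also have "(\<Sum>(r, s)\<in>?P. - (int (m l div m r) * a r s * coord x s * coord y r)) =
      (\<Sum>(i, j)\<in>?Q. - (upper i j * coords x j * coords y i))"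
    by (rule sum.reindex_bij_witness[where i = "\<lambda>(i, j). (Suc i, Suc j)" and j = "\<lambda>(r, s). (r - 1, s - 1)"])
      (auto simp: upper_def coords_def)
  also have "\<dots> = (\<Sum>(i, j)\<in>{..<l} \<times> {..<l}. - (upper i j * coords x j * coords y i))"
    by (rule sum.mono_neutral_left) (auto simp: upper_def)
  also have "\<dots> = - form (coords x) (coords y)"
    by (simp add: form_def sum.cartesian_product[symmetric] sum_negf)
  finally show ?thesis .
qed

lemma omega_eq_iff:
  assumes "x \<in> carrier G" "y \<in> carrier G"
  shows "\<omega> x y = \<omega> y x \<longleftrightarrow> M dvd (\<Sum>i<l. coords y i * (B *\<^sub>v vec l (coords x)) $ i)"
proof -
  have "primitive_root_of_unity (m l) (\<zeta> (m l))" using zeta_prim[of l] l by simp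
  from primitive_root_power_int_eq_iff[OF this] show ?thesis
    using assms form_antisymmetrized[of "coords y" "coords x"]
    by (simp add: omega_eq_form del: index_mult_mat_vec)
qed

lemma coords_mult:
  "i < l \<Longrightarrow> int (m (Suc i)) dvd coords (x \<otimes>\<^bsub>G\<^esub> y) i - (coords x i + coords y i)"
  unfolding coords_def by (rule coord_mult) simp

text \<open>
  The exponent is additive in both arguments modulo $m_l$, so the cocycle is even bimultiplicative.
\<close>

lemma omega_cocycle:
  assumes x: "x \<in> carrier G" and y: "y \<in> carrier G" and z: "z \<in> carrier G"
  shows "\<omega> x y * \<omega> (x \<otimes>\<^bsub>G\<^esub> y) z = \<omega> x (y \<otimes>\<^bsub>G\<^esub> z) * \<omega> y z"
proof -
  interpret comm_group G by (rule comm_group_G)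
  let ?c = coords
  have prim: "primitive_root_of_unity (m l) (\<zeta> (m l))" using zeta_prim[of l] l by simp
  have 1: "M dvd form (?c (x \<otimes>\<^bsub>G\<^esub> y)) (?c z) - form (\<lambda>i. ?c x i + ?c y i) (?c z)"
    by (rule dvd_form_diff_left) (rule coords_mult)
  have 2: "M dvd form (?c x) (?c (y \<otimes>\<^bsub>G\<^esub> z)) - form (?c x) (\<lambda>i. ?c y i + ?c z i)"
    by (rule dvd_form_diff_right) (rule coords_mult)
  have "form (\<lambda>i. ?c x i + ?c y i) (?c z) = form (?c x) (?c z) + form (?c y) (?c z)"
    "form (?c x) (\<lambda>i. ?c y i + ?c z i) = form (?c x) (?c y) + form (?c x) (?c z)"
    by (simp_all add: form_def sum.distrib algebra_simps)
  then have "M dvd (- form (?c x) (?c y) - form (?c (x \<otimes>\<^bsub>G\<^esub> y)) (?c z)) -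
      (- form (?c x) (?c (y \<otimes>\<^bsub>G\<^esub> z)) - form (?c y) (?c z))"
    using dvd_diff[OF 2 1] by (simp add: algebra_simps)
  then show ?thesis
    using x y z zeta_nonzero
    by (simp add: omega_eq_form power_int_add[symmetric] primitive_root_power_int_eq_iff[OF prim])
qed

lemma omega_nonzero: "\<lbrakk>x \<in> carrier G; y \<in> carrier G\<rbrakk> \<Longrightarrow> \<omega> x y \<noteq> 0"
  by (simp add: omega_eq_form zeta_nonzero)

lemma dvd_B_mult_diff:
  assumes vw: "\<And>j. j < l \<Longrightarrow> int (m (Suc j)) dvd v j - w j" and i: "i < l"
  shows "M dvd (B *\<^sub>v vec l v) $ i - (B *\<^sub>v vec l w) $ i"
proof -
  have "(B *\<^sub>v vec l v) $ i - (B *\<^sub>v vec l w) $ i = (\<Sum>j<l. (upper i j - upper j i) * (v j - w j))"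
    using i B_carrier
    by (simp add: scalar_prod_def atLeast0LessThan B_entry sum_subtractf[symmetric] algebra_simps)
  also have "M dvd \<dots>"
  proof (intro dvd_sum)
    fix j assume "j \<in> {..<l}"
    then have "M dvd upper i j * int (m (Suc j)) - upper j i * int (m (Suc j))" "j < l"
      using i dvd_upper(2)[of i j] dvd_upper(1)[of j i] by auto
    then have "M dvd (upper i j - upper j i) * int (m (Suc j))" by (simp add: algebra_simps)
    then show "M dvd (upper i j - upper j i) * (v j - w j)"
      using vw[OF \<open>j < l\<close>] by (rule dvd_mult_multiple)
  qed
  finally show ?thesis .
qed

lemma dvd_mult_B:
  assumes i: "i < l"
  shows "M dvd int (m (Suc i)) * (B *\<^sub>v vec l v) $ i"
proof -
  have "int (m (Suc i)) * (B *\<^sub>v vec l v) $ i =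
      (\<Sum>j<l. (upper i j * int (m (Suc i)) - upper j i * int (m (Suc i))) * v j)"
    using i B_carrier
    by (simp add: scalar_prod_def atLeast0LessThan B_entry sum_distrib_left algebra_simps)
  also have "M dvd \<dots>"
  proof (intro dvd_sum dvd_mult2)
    fix j assume "j \<in> {..<l}"
    then show "M dvd upper i j * int (m (Suc i)) - upper j i * int (m (Suc i))"
      using i dvd_upper(1)[of i j] dvd_upper(2)[of j i] by (intro dvd_diff) auto
  qed
  finally show ?thesis .
qed

text \<open>
  Regularity of $x$ says that $m_l$ divides $c(y)^T B\,c(x)$ for all $y$. Taking for $y$ the
  generators isolates the entries of $B\,c(x)$.
\<close>

lemma regular_elements_eq_kernel:
  "regular_elements G \<omega> = {x \<in> carrier G. \<forall>i<l. M dvd (B *\<^sub>v vec l (coords x)) $ i}"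
proof -
  have "(\<forall>y\<in>carrier G. \<omega> x y = \<omega> y x) \<longleftrightarrow> (\<forall>i<l. M dvd (B *\<^sub>v vec l (coords x)) $ i)"
    if x: "x \<in> carrier G" for x
  proof
    assume all: "\<forall>i<l. M dvd (B *\<^sub>v vec l (coords x)) $ i"
    show "\<forall>y\<in>carrier G. \<omega> x y = \<omega> y x"
    proof
      fix y assume "y \<in> carrier G"
      moreover have "M dvd (\<Sum>i<l. coords y i * (B *\<^sub>v vec l (coords x)) $ i)"
        using all by (intro dvd_sum dvd_mult) simp
      ultimately show "\<omega> x y = \<omega> y x" by (simp only: omega_eq_iff[OF x])
    qed
  next
    assume comm: "\<forall>y\<in>carrier G. \<omega> x y = \<omega> y x"
    show "\<forall>i<l. M dvd (B *\<^sub>v vec l (coords x)) $ i"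
    proof (intro allI impI)
      fix i assume i: "i < l"
      let ?b = "\<lambda>j. (B *\<^sub>v vec l (coords x)) $ j"
      define y where "y = element (\<lambda>r. if r = Suc i then 1 else 0)"
      have y: "y \<in> carrier G" by (simp add: y_def element_closed)
      \<comment> \<open>Only a congruence, because the exponent $1$ has coordinate $0$ if $m_{i+1} = 1$.\<close>
      have c: "int (m (Suc j)) dvd coords y j - (if j = i then 1 else 0)" if "j < l" for j
        using that by (simp add: coords_def y_def coord_element mod_eq_dvd_iff[symmetric])
      have 1: "M dvd (\<Sum>j<l. coords y j * ?b j)"
        using comm y omega_eq_iff[OF x y] by blast
      have "M dvd (\<Sum>j<l. (coords y j - (if j = i then 1 else 0)) * ?b j)"
      proof (intro dvd_sum)
        fix j assume "j \<in> {..<l}"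
        then have j: "j < l" by simp
        show "M dvd (coords y j - (if j = i then 1 else 0)) * ?b j"
          using dvd_mult_multiple[OF _ c[OF j], of "?b j"] dvd_mult_B[OF j]
          by (simp only: mult.commute)
      qed
      also have "(\<Sum>j<l. (coords y j - (if j = i then 1 else 0)) * ?b j) =
          (\<Sum>j<l. coords y j * ?b j) - (\<Sum>j<l. if j = i then ?b i else 0)"
        by (subst sum_subtractf[symmetric], intro sum.cong refl) (auto simp: left_diff_distrib simp del: index_mult_mat_vec)
      also have "(\<Sum>j<l. if j = i then ?b i else 0) = ?b i"
        using i by (simp del: index_mult_mat_vec)
      finally show "M dvd ?b i" using 1 by (metis dvd_diff_right_iff)
    qed
  qed
  then show ?thesis unfolding regular_elements_def by blast
qed

lemma card_fibre:
  assumes x: "x \<in> carrier G"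
  shows "card {f \<in> {..<l} \<rightarrow>\<^sub>E {0..<M}. \<forall>i<l. f i mod int (m (Suc i)) = coords x i} =
    (\<Prod>i<l. m l div m (Suc i))"
proof -
  have "{f \<in> {..<l} \<rightarrow>\<^sub>E {0..<M}. \<forall>i<l. f i mod int (m (Suc i)) = coords x i} =
      (\<Pi>\<^sub>E i\<in>{..<l}. {t \<in> {0..<M}. t mod int (m (Suc i)) = coords x i})"
    by (intro Set.set_eqI) (simp only: mem_Collect_eq PiE_iff Ball_def lessThan_iff, blast)
  then have "card {f \<in> {..<l} \<rightarrow>\<^sub>E {0..<M}. \<forall>i<l. f i mod int (m (Suc i)) = coords x i} =
      (\<Prod>i<l. card {t \<in> {0..<M}. t mod int (m (Suc i)) = coords x i})"
    by (simp only: card_PiE finite_lessThan)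
  also have "\<dots> = (\<Prod>i<l. nat (M div int (m (Suc i))))"
  proof (intro prod.cong refl card_residue_class_interval)
    fix i assume i: "i \<in> {..<l}"
    show "0 < int (m (Suc i))" using m_pos[of "Suc i"] i by simp
    show "int (m (Suc i)) dvd M" using m_dvd_mono[of "Suc i" l] i by simp
    show "0 \<le> coords x i" "coords x i < int (m (Suc i))"
      using coord_bounds[of "Suc i" x] i by (auto simp: coords_def)
  qed (rule M_pos)
  finally show ?thesis by (simp add: zdiv_int[symmetric])
qed

text \<open>
  Reducing the entries of $f$ modulo the $m_i$ gives the coordinates of an element of $G$, and
  whether $Bf \equiv 0$ holds modulo $m_l$ depends on that element only. So the solutions are the
  disjoint union of the fibres over the regular elements.
\<close>

lemma card_congruence_solutions_B:
  "card (congruence_solutions l M B) = card (regular_elements G \<omega>) * (\<Prod>i<l. m l div m (Suc i))"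
proof -
  let ?fibre = "\<lambda>x. {f \<in> {..<l} \<rightarrow>\<^sub>E {0..<M}. \<forall>i<l. f i mod int (m (Suc i)) = coords x i}"
  let ?R = "regular_elements G \<omega>"
  have RG: "?R \<subseteq> carrier G" by (auto simp: regular_elements_def)
  have dvd_iff: "(\<forall>i<l. M dvd (B *\<^sub>v vec l f) $ i) \<longleftrightarrow> (\<forall>i<l. M dvd (B *\<^sub>v vec l (coords x)) $ i)"
    if "\<forall>i<l. f i mod int (m (Suc i)) = coords x i" for f x
  proof -
    have "int (m (Suc i)) dvd f i - coords x i" if "i < l" for i
      using \<open>\<forall>i<l. _ i\<close> that by (metis mod_eq_dvd_iff mod_mod_trivial)
    then have "M dvd (B *\<^sub>v vec l f) $ i - (B *\<^sub>v vec l (coords x)) $ i" if "i < l" for i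
      using that by (intro dvd_B_mult_diff)
    then show ?thesis by (metis diff_add_cancel dvd_add_right_iff)
  qed
  have union: "congruence_solutions l M B = (\<Union>x\<in>?R. ?fibre x)"
  proof (intro equalityI subsetI)
    fix f assume f: "f \<in> congruence_solutions l M B"
    define x where "x = element (\<lambda>r. nat (f (r - 1)))"
    have x: "x \<in> carrier G" by (simp add: x_def element_closed)
    have fx: "\<forall>i<l. f i mod int (m (Suc i)) = coords x i"
    proof (intro allI impI)
      fix i assume i: "i < l"
      have "f i \<ge> 0" using f i PiE_mem[of f "{..<l}" "\<lambda>_. {0..<M}" i] by (simp add: congruence_solutions_def)
      then show "f i mod int (m (Suc i)) = coords x i"
        using i by (simp add: coords_def x_def coord_element)
    qed
    have "\<forall>i<l. M dvd (B *\<^sub>v vec l f) $ i" using f by (simp add: congruence_solutions_def)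
    then have "x \<in> ?R" using x dvd_iff[OF fx] unfolding regular_elements_eq_kernel by blast
    then show "f \<in> (\<Union>x\<in>?R. ?fibre x)"
      using f fx unfolding congruence_solutions_def by blast
  next
    fix f assume "f \<in> (\<Union>x\<in>?R. ?fibre x)"
    then obtain x where "x \<in> ?R" "f \<in> ?fibre x" by blast
    then show "f \<in> congruence_solutions l M B"
      using dvd_iff[of f x] unfolding regular_elements_eq_kernel congruence_solutions_def by blast
  qed
  have "card (congruence_solutions l M B) = (\<Sum>x\<in>?R. card (?fibre x))"
    unfolding union
  proof (rule card_UN_disjoint)
    show "finite ?R" using RG finite_carrier_G by (rule finite_subset)
    show "\<forall>x\<in>?R. finite (?fibre x)"
      by (rule ballI, rule finite_subset[of _ "{..<l} \<rightarrow>\<^sub>E {0..<M}"]) (blast, intro finite_PiE, auto)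
    show "\<forall>x\<in>?R. \<forall>y\<in>?R. x \<noteq> y \<longrightarrow> ?fibre x \<inter> ?fibre y = {}"
    proof (intro ballI impI, rule ccontr)
      fix x y assume xy: "x \<in> ?R" "y \<in> ?R" "x \<noteq> y" and "?fibre x \<inter> ?fibre y \<noteq> {}"
      then obtain f where "\<forall>i<l. f i mod int (m (Suc i)) = coords x i"
        "\<forall>i<l. f i mod int (m (Suc i)) = coords y i" by blast
      then have eq: "coords x i = coords y i" if "i < l" for i using that by metis
      have "coord x r = coord y r" if "r \<in> {1..l}" for r
        using eq[of "r - 1"] that by (cases r) (auto simp: coords_def)
      then show False using xy RG coord_inject[of x y] by blast
    qed
  qed
  also have "\<dots> = (\<Sum>x\<in>?R. (\<Prod>i<l. m l div m (Suc i)))"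
  proof (rule sum.cong[OF refl])
    fix x assume "x \<in> ?R"
    then have "x \<in> carrier G" using RG by blast
    then show "card (?fibre x) = (\<Prod>i<l. m l div m (Suc i))" by (rule card_fibre)
  qed
  finally show ?thesis by simp
qed

text \<open>
  Solve $|G_0| \prod_i m_l/m_i = \prod_i \gcd(m_l,s_i)$ for $|G_0|$, using $|G| = \prod_i m_i$.
\<close>

theorem card_regular_elements:
  assumes "smith_normal_form B S"
  shows "real (card (regular_elements G \<omega>)) =
    real (Coset.order G) / (\<Prod>i<l. real (m l) / real_of_int (gcd M (S $$ (i, i))))"
proof -
  have "(\<Prod>i<l. nat (gcd M (S $$ (i, i)))) = card (regular_elements G \<omega>) * (\<Prod>i<l. m l div m (Suc i))"
    using card_congruence_solutions_smith[OF B_carrier assms M_pos] card_congruence_solutions_B by simp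
  then have "(\<Prod>i<l. real (nat (gcd M (S $$ (i, i))))) =
      real (card (regular_elements G \<omega>)) * (\<Prod>i<l. real (m l div m (Suc i)))"
    by (simp only: of_nat_mult[symmetric] of_nat_prod[symmetric])
  also have "(\<Prod>i<l. real (nat (gcd M (S $$ (i, i))))) = (\<Prod>i<l. real_of_int (gcd M (S $$ (i, i))))"
    by simp
  also have "(\<Prod>i<l. real (m l div m (Suc i))) = (\<Prod>i<l. real (m l) / real (m (Suc i)))"
    using m_dvd_mono by (intro prod.cong refl real_of_nat_div) auto
  finally have eq: "(\<Prod>i<l. real_of_int (gcd M (S $$ (i, i)))) =
      real (card (regular_elements G \<omega>)) * (real (m l) ^ l / (\<Prod>i<l. real (m (Suc i))))"
    by (simp add: prod_dividef)
  have ord: "real (Coset.order G) = (\<Prod>i<l. real (m (Suc i)))"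
  proof -
    have "(\<Prod>r\<in>{1..l}. m r) = (\<Prod>i<l. m (Suc i))"
      by (rule prod.reindex_bij_witness[where i = Suc and j = "\<lambda>r. r - 1"]) auto
    then show ?thesis by (simp add: order_G)
  qed
  have "m (Suc i) \<noteq> 0" if "i < l" for i using m_pos[of "Suc i"] that by simp
  then have "(\<Prod>i<l. real (m (Suc i))) \<noteq> 0" by (subst prod_zero_iff) auto
  moreover have "(\<Prod>i<l. real_of_int (gcd M (S $$ (i, i)))) \<noteq> 0" using M_pos by simp
  moreover have "real (m l) ^ l \<noteq> 0" using M_pos by simp
  moreover have "c = n / (p / q)" if "n \<noteq> 0" "q \<noteq> 0" "p \<noteq> 0" "q = c * (p / n)" for c n p q :: real
    using that by (auto simp: field_simps)
  ultimately show ?thesis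
    using eq unfolding ord prod_dividef by (simp only: prod_constant card_lessThan)
qed

end

text \<open>
  Passing from the diagonal of the Smith normal form to the invariant factors drops the zero
  entries, which contribute trivial factors.
\<close>

lemma prod_list_filter_nonzero:
  fixes F :: "int \<Rightarrow> real"
  assumes "F 0 = 1"
  shows "(\<Prod>c\<leftarrow>filter (\<lambda>c. c \<noteq> 0) (map d [0..<n]). F c) = (\<Prod>i<n. F (d i))"
proof -
  have "(\<Prod>c\<leftarrow>filter (\<lambda>c. c \<noteq> 0) xs. F c) = (\<Prod>c\<leftarrow>xs. F c)" for xs
    using assms by (induction xs) auto
  then show ?thesis
    by (simp add: prod.distinct_set_conv_list[symmetric] atLeast0LessThan comp_def)
qed

section \<open>The number of regular elements and the dimension\<close>

theorem proposition4p3: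
  fixes l :: nat
    and m :: "nat \<Rightarrow> nat"
    and G :: "(nat \<Rightarrow> int) monoid"
    and g :: "nat \<Rightarrow> nat \<Rightarrow> int"
    and \<zeta> :: "nat \<Rightarrow> 'k::{alg_closed_field, field_char_0}"
    and a :: "nat \<Rightarrow> nat \<Rightarrow> int"
    and \<omega> :: "(nat \<Rightarrow> int) \<Rightarrow> (nat \<Rightarrow> int) \<Rightarrow> 'k"
    and lams :: "int list"
  assumes G: "G = cyclic_product l m"
    and l: "l \<ge> 1"
    and m_pos: "\<And>r. r \<in> {1..l} \<Longrightarrow> m r \<ge> 1"
    and m_dvd: "\<And>r. r \<in> {1..<l} \<Longrightarrow> m r dvd m (Suc r)"
    and g: "\<And>r. r \<in> {1..l} \<Longrightarrow> g r \<in> carrier G \<and> generate G {g r} = cyclic_factor l m r"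
    and zeta_prim: "\<And>r. r \<in> {1..l} \<Longrightarrow> primitive_root_of_unity (m r) (\<zeta> (m r))"
    and zeta_compat: "\<And>r. r \<in> {1..l} \<Longrightarrow> \<zeta> (m r) = \<zeta> (m l) ^ (m l div m r)"
    and a_bounds: "\<And>r s. 1 \<le> r \<Longrightarrow> r < s \<Longrightarrow> s \<le> l \<Longrightarrow> 0 \<le> a r s \<and> a r s < int (m r)"
    and omega: "\<And>i j :: nat \<Rightarrow> nat.
       (\<And>r. r \<in> {1..l} \<Longrightarrow> i r < m r \<and> j r < m r) \<Longrightarrow>
       \<omega> (\<Otimes>\<^bsub>G\<^esub>r\<in>{1..l}. g r [^]\<^bsub>G\<^esub> i r) (\<Otimes>\<^bsub>G\<^esub>r\<in>{1..l}. g r [^]\<^bsub>G\<^esub> j r) =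
         (\<Prod>(r, s)\<in>{(r, s). 1 \<le> r \<and> r < s \<and> s \<le> l}.
            \<zeta> (m r) powi (- (a r s * int (i s) * int (j r))))"
    and lams: "invariant_factors (B_matrix l m a) lams"
  shows
    "real (card (regular_elements G \<omega>)) =
       real (Coset.order G) / (\<Prod>c\<leftarrow>lams. real (m l) / real_of_int (gcd (int (m l)) c)) \<and>
     (\<exists>(V :: ((nat \<Rightarrow> int) \<Rightarrow> 'k) set) \<rho>.
        irreducible_projective_representation (\<lambda>c f x. c * f x) G \<omega> V \<rho>) \<and>
     (\<forall>(scale :: 'k \<Rightarrow> 'v::ab_group_add \<Rightarrow> 'v) V \<rho>.
        irreducible_projective_representation scale G \<omega> V \<rho> \<longrightarrow>
        real (vector_space.dim scale V) =
          sqrt (\<Prod>c\<leftarrow>lams. real (m l) / real_of_int (gcd (int (m l)) c)))"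
proof -
  interpret D: cyclic_product_cocycle l m g \<zeta> a \<omega>
    by unfold_locales (fact l m_pos m_dvd g[unfolded G] zeta_prim zeta_compat omega[unfolded G])+
  have G_eq: "D.G = G" by (simp add: G)
  interpret W: finite_abelian_cocycle G \<omega>
    unfolding finite_abelian_cocycle_def finite_abelian_cocycle_axioms_def
    using D.comm_group_G D.finite_carrier_G D.omega_nonzero D.omega_cocycle
    unfolding G_eq by blast
  let ?F = "\<lambda>c. real (m l) / real_of_int (gcd (int (m l)) c)"
  let ?P = "\<Prod>c\<leftarrow>lams. ?F c"
  obtain S where S: "smith_normal_form (B_matrix l m a) S"
    and lams_eq: "lams = filter (\<lambda>c. c \<noteq> 0) (map (\<lambda>i. S $$ (i, i)) [0..<l])"
    using lams D.B_carrier unfolding invariant_factors_def by auto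
  have "?F 0 = 1" using D.M_pos by simp
  then have P: "?P = (\<Prod>i<l. ?F (S $$ (i, i)))"
    unfolding lams_eq by (rule prod_list_filter_nonzero)
  have card: "real (card (regular_elements G \<omega>)) = real (Coset.order G) / ?P"
    using D.card_regular_elements[OF S] unfolding P G_eq .
  have P_pos: "?P > 0" unfolding P using D.M_pos by (intro prod_pos) simp
  have order_pos: "real (Coset.order G) > 0"
    using W.finite_carrier W.order_gt_0_iff_finite by simp
  have "real (vector_space.dim scale V) = sqrt ?P"
    if irr: "irreducible_projective_representation scale G \<omega> V \<rho>"
    for scale :: "'k \<Rightarrow> 'v::ab_group_add \<Rightarrow> 'v" and V \<rho>
  proof -
    interpret R: abelian_irreducible_representation G \<omega> scale V \<rho>
      by (intro abelian_irreducible_representation.intro W.finite_abelian_cocycle_axioms irr)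
    have "real (R.dim V) ^ 2 * real (card (regular_elements G \<omega>)) = real (Coset.order G)"
      using R.dim_squared by (metis of_nat_mult of_nat_power)
    then have "real (R.dim V) ^ 2 = ?P"
      using P_pos order_pos by (simp add: card field_simps)
    then show ?thesis by (metis of_nat_0_le_iff real_sqrt_unique)
  qed
  then show ?thesis using card W.irreducible_representation_exists by blast
qed

end
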